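(* Let $n\le 3$, let $\Delta\subset\mathbb{R}^n$ be a nondegenerate $n$-simplex with faces $F_0,\dots,F_n$ and normalized outward normals $\mathbf{k}_0,\dots,\mathbf{k}_n$, and let $\mathcal{P}=\{p_0,\dots,p_n\}$ be a contact set with $p_i$ in the relative interior of $F_i$ for each $i$. If the matrix $A=\sum_{i=0}^n\mathbf{k}_ip_i^T$ is symmetric, then $\mathcal{P}$ immobilizes $\Delta$.
   Context: $\Delta$ has vertices $v_0,\dots,v_n$, ordered so that $\mathrm{vol}(\Delta)=\frac{1}{n!}\det[v_1-v_0,\dots,v_n-v_0]>0$. $F_i$ is the face of $\Delta$ opposite $v_i$ (with vertices $v_j$, $j\ne i$). $\mathbf{k}_i$ is the outward pointing normal to $F_i$ with $|\mathbf{k}_i|=\mathrm{vol}(F_i)$ (the $(n-1)$-dimensional volume); then $\sum_{i=0}^n\mathbf{k}_i=\mathbf{0}$. Vectors are columns, so $A$ is an $n\times n$ matrix. $\mathbb{E}_n$ is the group of (orientation preserving) rigid motions $x\mapsto Rx+\underline{a}$ of $\mathbb{R}^n$, $R\in SO(n)$, with its usual topology. $\mathcal{P}$ immobilizes $\Delta$ if there is a neighbourhood $N$ of the identity in $\mathbb{E}_n$ such that for every $g\in N$, $g\neq I$, at least one $g(p_i)$ lies in the interior of $\Delta$. *)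

theory Defs
  imports "HOL-Analysis.Analysis"
begin

text \<open>
  The \<open>n + 1\<close> indices \<open>0, 1, \<dots>, n\<close> are the elements of \<^typ>\<open>'n option\<close>, where \<open>n = CARD('n)\<close>:
  \<^term>\<open>None\<close> is the index \<open>0\<close>, and \<open>Some c\<close> with \<open>c :: 'n\<close> are the remaining \<open>n\<close>.  Thus
  \<open>[v\<^sub>1 - v\<^sub>0, \<dots>, v\<^sub>n - v\<^sub>0]\<close> has both its rows and its columns indexed by \<^typ>\<open>'n\<close>, and its
  determinant does not depend on how \<^typ>\<open>'n\<close> is enumerated.
\<close>

definition edge_matrix :: "('n option \<Rightarrow> real^'n) \<Rightarrow> real^'n^'n" where
  "edge_matrix v = (\<chi> r c. (v (Some c) - v None) $ r)"

definition ordered_simplex :: "('n option \<Rightarrow> real^'n) \<Rightarrow> bool" where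
  "ordered_simplex v \<longleftrightarrow>
     inj v \<and> \<not> affine_dependent (range v) \<and> det (edge_matrix v) > 0"

definition solid :: "('n option \<Rightarrow> real^'n) \<Rightarrow> (real^'n) set" where
  "solid v = convex hull (range v)"

definition face :: "('n option \<Rightarrow> real^'n) \<Rightarrow> 'n option \<Rightarrow> (real^'n) set" where
  "face v i = convex hull (v ` (UNIV - {i}))"

definition frame_point :: "nat \<Rightarrow> 'a::euclidean_space \<Rightarrow> (nat \<Rightarrow> 'a) \<Rightarrow> (nat \<Rightarrow> real) \<Rightarrow> 'a" where
  "frame_point m a b x = a + (\<Sum>j<m. x j *\<^sub>R b j)"

definition flat_frame :: "nat \<Rightarrow> 'a::euclidean_space set \<Rightarrow> 'a \<Rightarrow> (nat \<Rightarrow> 'a) \<Rightarrow> bool" where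
  "flat_frame m S a b \<longleftrightarrow>
     (\<forall>i<m. \<forall>j<m. b i \<bullet> b j = (if i = j then 1 else 0)) \<and> S \<subseteq> range (frame_point m a b)"

text \<open>
  The \<open>m\<close>-dimensional volume of a (Borel) set \<open>S\<close> lying in an \<open>m\<close>-dimensional affine subspace:
  the Lebesgue measure of \<open>S\<close> read in Cartesian coordinates on that subspace.  The value does not
  depend on the chosen origin and orthonormal frame.  It is a junk value if \<open>S\<close> lies in no such
  subspace.  The product measure over the explicit index set \<open>{..<m}\<close>
  admits \<open>m = 0\<close>, where a single point has volume \<open>1\<close>.
\<close>

definition flat_volume :: "nat \<Rightarrow> 'a::euclidean_space set \<Rightarrow> real" where
  "flat_volume m S =
     (let (a, b) = (SOME (a, b). flat_frame m S a b);
          L = (\<Pi>\<^sub>M j\<in>{..<m}. (lborel :: real measure))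
      in measure L {x \<in> space L. frame_point m a b x \<in> S})"

definition normalized_outward_normal ::
    "('n option \<Rightarrow> real^'n) \<Rightarrow> 'n option \<Rightarrow> real^'n \<Rightarrow> bool" where
  "normalized_outward_normal v i k \<longleftrightarrow>
     (\<forall>x\<in>face v i. \<forall>y\<in>face v i. k \<bullet> (y - x) = 0) \<and>
     (\<forall>x\<in>face v i. \<forall>y\<in>interior (solid v). k \<bullet> (y - x) < 0) \<and>
     norm k = flat_volume (CARD('n) - 1) (face v i)"

text \<open>
  The motion \<open>x \<mapsto> R x + a\<close> is represented by the pair \<open>(R, a)\<close>; the identity is \<open>(mat 1, 0)\<close>, and
  the topology of the group of rigid motions is the one induced from pairs of a matrix and a vector.
\<close>

definition rigid_motions :: "((real^'n^'n) \<times> (real^'n)) set" where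
  "rigid_motions = {R. rotation_matrix R} \<times> UNIV"

definition move :: "(real^'n^'n) \<times> (real^'n) \<Rightarrow> real^'n \<Rightarrow> real^'n" where
  "move g x = fst g *v x + snd g"

definition immobilizes :: "(real^'n) set \<Rightarrow> (real^'n) set \<Rightarrow> bool" where
  "immobilizes P D \<longleftrightarrow>
     (\<exists>N. openin (top_of_set rigid_motions) N \<and> (mat 1, 0) \<in> N \<and>
          (\<forall>g\<in>N. g \<noteq> (mat 1, 0) \<longrightarrow> (\<exists>p\<in>P. move g p \<in> interior D)))"

definition contact_matrix :: "('n option \<Rightarrow> real^'n) \<Rightarrow> ('n option \<Rightarrow> real^'n) \<Rightarrow> real^'n^'n" where
  "contact_matrix k p =
     (\<Sum>i\<in>UNIV. (columnvector (k i) :: real^1^'n) ** (rowvector (p i) :: real^'n^1))"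

end

theory Submission
  imports Defs
begin

text \<open>
  Let \<open>g\<close>, given by \<open>x \<mapsto> R x + a\<close>, be a motion close to the identity.  Since \<open>p\<^sub>i\<close> lies strictly
  inside every facet hyperplane other than its own, \<open>g p\<^sub>i\<close> can fail to be interior to the simplex
  only by violating the constraint of facet \<open>i\<close>, that is \<open>k\<^sub>i \<bullet> (g p\<^sub>i - p\<^sub>i) \<ge> 0\<close>.  If this
  happens for all \<open>i\<close>, the sum of these numbers is nonnegative; the translation drops out of the sum
  because \<open>\<Sum>k\<^sub>i = 0\<close>, and what remains is \<open>tr (A (R - I))\<close> for the symmetric matrix \<open>A\<close>.  So it
  suffices that \<open>tr (A (R - I)) < 0\<close> whenever \<open>R \<noteq> I\<close>: then \<open>R = I\<close>, the numbers \<open>k\<^sub>i \<bullet> a \<ge> 0\<close> add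
  up to zero, hence all vanish, and \<open>a = 0\<close> because the normals span the space.

  Sign of the trace.  Against a symmetric \<open>A\<close> only the symmetric part of \<open>R - I\<close> counts, and with the
  skew Cayley transform \<open>S\<close> of \<open>R\<close> this part is a positive multiple of \<open>S\<^sup>2\<close> in dimension at most
  three (there \<open>S\<^sup>3\<close> is a multiple of \<open>S\<close>).  In dimension two \<open>S\<^sup>2\<close> is a negative multiple of \<open>I\<close>;
  in dimension three \<open>tr (A S\<^sup>2) = w \<bullet> A w - tr A \<bar>w\<bar>\<^sup>2\<close> for the axial vector \<open>w\<close> of \<open>S\<close>.  So
  \<open>trace_rotation_defect_neg\<close> asks for \<open>tr A > 0\<close> and, in dimension three, for the eigenvalues of \<open>A\<close>
  to be smaller than its trace.

  Eigenvalues of \<open>A\<close>.  The normals are, up to one common negative factor, the gradients of the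
  barycentric coordinates.  Hence, \<open>A\<close> being symmetric, \<open>- A / tr A\<close> is the linear part of the affine
  map with \<open>v\<^sub>i \<mapsto> p\<^sub>i\<close>.  In barycentric coordinates this map is a stochastic matrix with zero
  diagonal and positive off-diagonal entries, so every eigenvalue on vectors of coordinate sum zero is
  smaller than one in modulus; this is \<open>eigenvalue_bound\<close>, applied in \<open>contact_matrix_rayleigh\<close>.

  The common factor.  That \<open>vol(F\<^sub>i)\<close> times the height over \<open>F\<^sub>i\<close> is the same for all facets is the
  one fact about volumes that is used; it also yields \<open>\<Sum>k\<^sub>i = 0\<close>.  The prism over \<open>F\<^sub>i\<close> with lateral
  edge \<open>v\<^sub>i - v\<^sub>l\<close> has volume \<open>\<bar>k\<^sub>i \<bullet> (v\<^sub>i - v\<^sub>l)\<bar>\<close> (\<open>measure_prism\<close>), and the affine involution that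
  exchanges \<open>v\<^sub>i\<close> and \<open>v\<^sub>l\<close> and fixes the other vertices preserves volume and takes this prism to the
  one over \<open>F\<^sub>l\<close> with edge \<open>v\<^sub>l - v\<^sub>i\<close> (\<open>measure_prism_exchange\<close>).
\<close>

section \<open>Lebesgue measure of a prism over a flat base\<close>

definition prism :: "'a::real_vector set \<Rightarrow> 'a \<Rightarrow> 'a set" where
  "prism S u = {x + t *\<^sub>R u | x t. x \<in> S \<and> 0 \<le> t \<and> t \<le> 1}"

lemma measurable_vec_of_pair:
  fixes h :: "'w::finite \<Rightarrow> nat"
  assumes "\<And>c. h c \<noteq> m \<Longrightarrow> h c < m"
  shows "(\<lambda>z. (\<chi> c. if h c = m then snd z else fst z (h c)) :: real^'w)
    \<in> borel_measurable ((\<Pi>\<^sub>M j\<in>{..<m}. lborel) \<Otimes>\<^sub>M lborel)"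
    (is "?\<Phi> \<in> borel_measurable ?P")
proof (subst borel_measurable_euclidean_space, intro ballI)
  fix b :: "real^'w" assume "b \<in> Basis"
  then obtain c where c: "b = axis c 1" by (auto simp: Basis_vec_def)
  show "(\<lambda>z. ?\<Phi> z \<bullet> b) \<in> borel_measurable ?P"
    using assms[of c] by (cases "h c = m") (auto simp: c inner_axis)
qed

text \<open>
  The enumeration \<open>h\<close> of the coordinates identifies \<open>\<real>\<^sup>m \<times> \<real>\<close> with \<open>\<real>\<^sup>m\<^sup>+\<^sup>1\<close>: the first factor will
  carry a flat base set and the coordinate with number \<open>m\<close> the direction transverse to it.  Both
  measures agree on boxes.
\<close>

lemma lborel_vec_eq_distr_pair:
  fixes h :: "'w::finite \<Rightarrow> nat"
  assumes h: "bij_betw h UNIV {..<Suc m}"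
  shows "(lborel :: (real^'w) measure) =
    distr ((\<Pi>\<^sub>M j\<in>{..<m}. lborel) \<Otimes>\<^sub>M lborel) borel
      (\<lambda>z. \<chi> c. if h c = m then snd z else fst z (h c))"
    (is "_ = distr ?P borel ?\<Phi>")
proof (rule lborel_eqI)
  interpret product_sigma_finite "\<lambda>_::nat. lborel :: real measure" ..
  have hc: "h c \<noteq> m \<Longrightarrow> h c < m" for c
    using bij_betwE[OF h] by (metis UNIV_I lessThan_iff less_Suc_eq)
  have meas: "?\<Phi> \<in> borel_measurable ?P"
    by (rule measurable_vec_of_pair) (rule hc)
  fix l u :: "real^'w"
  assume le: "\<And>b. b \<in> Basis \<Longrightarrow> l \<bullet> b \<le> u \<bullet> b"
  have le': "l $ c \<le> u $ c" for c
    using le[of "axis c 1"] by (auto simp: inner_axis Basis_vec_def)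
  define f where "f = inv h"
  have hf: "h (f j) = j" if "j < Suc m" for j
    unfolding f_def using h that by (metis bij_betw_imp_surj_on f_inv_into_f lessThan_iff)
  have fh: "f (h c) = c" for c
    unfolding f_def using h by (simp add: bij_betw_def)
  define Q where "Q = (\<Pi>\<^sub>E j\<in>{..<m}. {l $ f j <..< u $ f j})"
  have "?\<Phi> -` box l u \<inter> space ?P = Q \<times> {l $ f m <..< u $ f m}"
  proof (intro equalityI subsetI)
    fix z assume z: "z \<in> ?\<Phi> -` box l u \<inter> space ?P"
    obtain x t where xt: "z = (x, t)" by (cases z)
    have sp: "x \<in> extensional {..<m}"
      using z by (auto simp: xt space_pair_measure space_PiM PiE_def)
    have b: "l $ c < ?\<Phi> z $ c \<and> ?\<Phi> z $ c < u $ c" for c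
      using z by (simp add: mem_box_cart)
    have "x j \<in> {l $ f j <..< u $ f j}" if "j < m" for j
      using b[of "f j"] hf[of j] that by (simp add: xt)
    moreover have "t \<in> {l $ f m <..< u $ f m}"
      using b[of "f m"] hf[of m] by (simp add: xt)
    ultimately show "z \<in> Q \<times> {l $ f m <..< u $ f m}"
      using sp by (auto simp: xt Q_def PiE_def)
  next
    fix z assume z: "z \<in> Q \<times> {l $ f m <..< u $ f m}"
    obtain x t where xt: "z = (x, t)" by (cases z)
    have x: "j < m \<Longrightarrow> l $ f j < x j \<and> x j < u $ f j" for j
      using z by (auto simp: xt Q_def PiE_def Pi_def)
    have t: "l $ f m < t \<and> t < u $ f m"
      using z by (auto simp: xt)
    have "l $ c < ?\<Phi> z $ c \<and> ?\<Phi> z $ c < u $ c" for c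
      using x[of "h c"] t hc[of c] fh[of c] by (cases "h c = m") (auto simp: xt)
    moreover have "z \<in> space ?P"
      using z by (auto simp: xt space_pair_measure space_PiM Q_def PiE_def)
    ultimately show "z \<in> ?\<Phi> -` box l u \<inter> space ?P"
      by (simp add: mem_box_cart)
  qed
  then have "emeasure (distr ?P borel ?\<Phi>) (box l u) = emeasure ?P (Q \<times> {l $ f m <..< u $ f m})"
    using meas by (simp add: emeasure_distr)
  also have "\<dots> = emeasure (\<Pi>\<^sub>M j\<in>{..<m}. lborel) Q * emeasure lborel {l $ f m <..< u $ f m}"
    unfolding Q_def by (rule lborel.emeasure_pair_measure_Times) (auto intro!: sets_PiM_I_finite)
  also have "emeasure (\<Pi>\<^sub>M j\<in>{..<m}. lborel) Q = (\<Prod>j<m. emeasure lborel {l $ f j <..< u $ f j})"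
    unfolding Q_def by (rule emeasure_PiM) auto
  also have "\<dots> * emeasure lborel {l $ f m <..< u $ f m} = (\<Prod>j<Suc m. ennreal (u $ f j - l $ f j))"
    using le' by simp
  also have "\<dots> = (\<Prod>c\<in>UNIV. ennreal (u $ c - l $ c))"
    by (subst prod.reindex_bij_betw[OF h, symmetric]) (simp add: fh)
  also have "\<dots> = ennreal (\<Prod>c\<in>UNIV. u $ c - l $ c)"
    using le' by (intro prod_ennreal) auto
  also have "(\<Prod>c\<in>UNIV. u $ c - l $ c) = (\<Prod>b\<in>Basis. (u - l) \<bullet> b)"
    unfolding Basis_vec_def
    by (simp add: image_image UNION_singleton_eq_range inner_axis prod.reindex inj_on_def axis_eq_axis)
  finally show "emeasure (distr ?P borel ?\<Phi>) (box l u) = (\<Prod>b\<in>Basis. (u - l) \<bullet> b)" .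
qed simp

lemma flat_frame_inner:
  "flat_frame m S a b \<Longrightarrow> i < m \<Longrightarrow> j < m \<Longrightarrow> b i \<bullet> b j = (if i = j then 1 else 0)"
  by (simp add: flat_frame_def)

lemma flat_frame_point:
  assumes "flat_frame m S a b" "s \<in> S"
  obtains x where "x \<in> extensional {..<m}" "frame_point m a b x = s"
proof -
  obtain y where y: "frame_point m a b y = s"
    using assms by (fastforce simp: flat_frame_def)
  have "frame_point m a b (restrict y {..<m}) = s"
    unfolding y[symmetric] frame_point_def by (intro arg_cong2[where f="(+)"] sum.cong) auto
  then show thesis by (intro that[of "restrict y {..<m}"]) auto
qed

lemma frame_point_inner:
  assumes "flat_frame m S a b" "j < m"
  shows "b j \<bullet> (frame_point m a b x - a) = x j"
proof -
  have "b j \<bullet> (frame_point m a b x - a) = (\<Sum>i<m. x i * (if j = i then 1 else 0))"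
    unfolding frame_point_def using assms
    by (simp add: inner_sum_right flat_frame_inner)
  also have "\<dots> = (\<Sum>i<m. if j = i then x i else 0)" by (intro sum.cong) auto
  finally show ?thesis using assms(2) by simp
qed

text \<open>
  Cramer's rule: the coefficient of \<open>u\<close> along column \<open>k\<close> in the orthonormal basis of columns is an
  inner product.
\<close>

lemma abs_det_replace_column:
  fixes Q :: "real^'n^'n"
  assumes "orthogonal_matrix Q"
  shows "\<bar>det (\<chi> r c. if c = k then u $ r else Q $ r $ c)\<bar> = \<bar>column k Q \<bullet> u\<bar>"
proof -
  have "Q ** transpose Q = mat 1"
    using assms by (simp add: orthogonal_matrix_def)
  then have u: "Q *v (transpose Q *v u) = u"
    by (metis matrix_vector_mul_assoc matrix_vector_mul_lid)
  have "(transpose Q *v u) $ k = column k Q \<bullet> u"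
    by (simp add: matrix_vector_mult_def transpose_def column_def inner_vec_def)
  then show ?thesis
    using cramer_lemma[of k Q "transpose Q *v u", unfolded u] det_orthogonal_matrix[OF assms]
    by auto
qed

text \<open>
  Base times height.  The prism is the affine image of (coordinate set of \<open>S\<close>) \<open>\<times> [0, 1]\<close> under the
  matrix with columns \<open>b\<^sub>0, \<dots>, b\<^sub>m\<^sub>-\<^sub>1, u\<close>; its determinant is \<open>\<plusminus> N \<bullet> u\<close>,
  because putting \<open>N\<close> in place of \<open>u\<close> makes it orthogonal.
\<close>

lemma measure_prism:
  fixes S :: "(real^'w::{finite,wellorder}) set"
  assumes card: "CARD('w) = Suc m" and S: "compact S" and fr: "flat_frame m S a b"
    and N: "norm N = 1" "\<And>j. j < m \<Longrightarrow> N \<bullet> b j = 0"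
  shows "measure lebesgue (prism S u) =
    measure (\<Pi>\<^sub>M j\<in>{..<m}. lborel) {x \<in> space (\<Pi>\<^sub>M j\<in>{..<m}. lborel). frame_point m a b x \<in> S}
      * \<bar>N \<bullet> u\<bar>"
proof -
  let ?L = "\<Pi>\<^sub>M j\<in>{..<m}. (lborel :: real measure)"
  obtain h :: "'w \<Rightarrow> nat" where h: "bij_betw h UNIV {..<Suc m}"
    using ex_bij_betw_finite_nat[of "UNIV :: 'w set"] card by (auto simp: atLeast0LessThan)
  define f where "f = inv h"
  have hf: "h (f j) = j" if "j < Suc m" for j
    unfolding f_def using h that by (metis bij_betw_imp_surj_on f_inv_into_f lessThan_iff)
  have fh: "f (h c) = c" for c
    unfolding f_def using h by (simp add: bij_betw_def)
  have f: "bij_betw f {..<Suc m} UNIV"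
    by (rule bij_betw_byWitness[where f'=h]) (use hf fh bij_betwE[OF h] in auto)
  have hc: "h c \<noteq> m \<Longrightarrow> h c < m" for c
    using bij_betwE[OF h] by (metis UNIV_I lessThan_iff less_Suc_eq)
  define col where "col w c = (if h c = m then w else b (h c))" for w :: "(real,'w) vec" and c
  define M where "M w = (\<chi> r c. col w c $ r)" for w :: "(real,'w) vec"
  have Mv: "M w *v z = (\<Sum>j<m. z $ f j *\<^sub>R b j) + z $ f m *\<^sub>R w" for w z
  proof -
    have "M w *v z = (\<Sum>c\<in>UNIV. z $ c *\<^sub>R col w c)"
      by (simp add: vec_eq_iff matrix_vector_mult_def M_def mult.commute)
    also have "\<dots> = (\<Sum>j<Suc m. z $ f j *\<^sub>R col w (f j))"
      by (rule sum.reindex_bij_betw[OF f, symmetric])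
    finally show ?thesis
      by (simp add: col_def hf)
  qed
  have "orthogonal_matrix (M N)"
  proof -
    have c: "column c (M N) = col N c" for c
      by (simp add: vec_eq_iff M_def column_def)
    have "norm (col N c) = 1" for c
      using N hc[of c] flat_frame_inner[OF fr] by (auto simp: col_def norm_eq_1)
    moreover have "col N c \<bullet> col N c' = 0" if "c \<noteq> c'" for c c'
    proof -
      have "h c \<noteq> h c'" using that fh by metis
      then show ?thesis
        using N hc[of c] hc[of c'] flat_frame_inner[OF fr]
        by (auto simp: col_def inner_commute[of _ N])
    qed
    ultimately show ?thesis
      by (simp add: orthogonal_matrix_orthonormal_columns c orthogonal_def)
  qed
  then have "\<bar>det (\<chi> r c. if c = f m then u $ r else M N $ r $ c)\<bar> = \<bar>column (f m) (M N) \<bullet> u\<bar>"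
    by (rule abs_det_replace_column)
  moreover have "(\<chi> r c. if c = f m then u $ r else M N $ r $ c) = M u"
    using fh by (auto simp: M_def col_def vec_eq_iff hf)
  moreover have "column (f m) (M N) = N"
    by (simp add: column_def M_def col_def hf vec_eq_iff)
  ultimately have det: "\<bar>det (M u)\<bar> = \<bar>N \<bullet> u\<bar>"
    by simp
  define Z where "Z = {z :: (real,'w) vec. a + (\<Sum>j<m. z $ f j *\<^sub>R b j) \<in> S} \<inter> {z. z $ f m \<in> {0..1}}"
  have fp: "frame_point m a b (\<lambda>j. z $ f j) = a + (\<Sum>j<m. z $ f j *\<^sub>R b j)" for z :: "(real,'w) vec"
    by (simp add: frame_point_def)
  have prism: "prism S u = (+) a ` ((*v) (M u) ` Z)"
  proof -
    have "prism S u \<subseteq> (+) a ` ((*v) (M u) ` Z)"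
    proof
      fix y assume "y \<in> prism S u"
      then obtain s t where st: "s \<in> S" "0 \<le> t" "t \<le> 1" "y = s + t *\<^sub>R u"
        by (auto simp: prism_def)
      obtain x where x: "frame_point m a b x = s"
        using flat_frame_point[OF fr st(1)] .
      define z :: "(real,'w) vec" where "z = (\<chi> c. if h c = m then t else x (h c))"
      have z: "z $ f m = t" "j < m \<Longrightarrow> z $ f j = x j" for j
        using hf by (simp_all add: z_def)
      have "a + (\<Sum>j<m. z $ f j *\<^sub>R b j) = s"
        unfolding x[symmetric] frame_point_def by (simp add: z)
      then have "z \<in> Z" "y = a + M u *v z"
        using st by (auto simp: Z_def Mv z algebra_simps)
      then show "y \<in> (+) a ` ((*v) (M u) ` Z)" by blast
    qed
    moreover have "(+) a ` ((*v) (M u) ` Z) \<subseteq> prism S u"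
    proof -
      have "a + M u *v z \<in> prism S u" if "z \<in> Z" for z
        using that unfolding prism_def Z_def Mv
        by (force simp: add.assoc)
      then show ?thesis by blast
    qed
    ultimately show ?thesis by blast
  qed
  have "compact Z"
  proof -
    have "closed Z"
      unfolding Z_def using compact_imp_closed[OF S]
      by (intro closed_Int closed_Collect_le closed_vimage[unfolded vimage_def] continuous_intros) auto
    moreover have "bounded Z"
    proof -
      obtain B where B: "\<And>s. s \<in> S \<Longrightarrow> norm (s - a) \<le> B"
        using compact_imp_bounded[OF compact_translation_subtract[OF S, of a]]
        by (auto simp: bounded_iff)
      have "\<bar>z $ c\<bar> \<le> max B 1" if z: "z \<in> Z" for z c
      proof (cases "h c = m")
        case True
        then have "z $ c \<in> {0..1}" using z fh[of c] by (auto simp: Z_def)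
        then show ?thesis by auto
      next
        case False
        let ?s = "a + (\<Sum>j<m. z $ f j *\<^sub>R b j)"
        have "z $ c = b (h c) \<bullet> (?s - a)"
          using frame_point_inner[OF fr hc[OF False], of "\<lambda>j. z $ f j"] by (simp add: fp fh)
        also have "\<bar>\<dots>\<bar> \<le> norm (b (h c)) * norm (?s - a)"
          by (rule Cauchy_Schwarz_ineq2)
        also have "norm (b (h c)) = 1"
          using flat_frame_inner[OF fr] hc[OF False] by (simp add: norm_eq_1)
        finally show ?thesis using B[of ?s] z by (auto simp: Z_def)
      qed
      then have "norm z \<le> (\<Sum>c\<in>(UNIV :: 'w set). max B 1)" if "z \<in> Z" for z
        using that by (intro order_trans[OF norm_le_l1_cart] sum_mono) auto
      then show ?thesis unfolding bounded_iff by blast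
    qed
    ultimately show ?thesis by (simp add: compact_eq_bounded_closed)
  qed
  define X where "X = {x \<in> space ?L. frame_point m a b x \<in> S}"
  have X: "X \<in> sets ?L"
  proof -
    have "(\<lambda>x. frame_point m a b x) \<in> borel_measurable ?L"
      unfolding frame_point_def by measurable
    then have "(\<lambda>x. frame_point m a b x) -` S \<inter> space ?L \<in> sets ?L"
      by (rule measurable_sets) (simp add: borel_compact S)
    then show ?thesis by (simp add: X_def vimage_def Int_def conj_commute)
  qed
  let ?\<Phi> = "\<lambda>z. (\<chi> c. if h c = m then snd z else fst z (h c)) :: (real,'w) vec"
  have meas: "?\<Phi> \<in> borel_measurable (?L \<Otimes>\<^sub>M lborel)"
    by (rule measurable_vec_of_pair) (rule hc)
  have "emeasure lborel Z = emeasure (?L \<Otimes>\<^sub>M lborel) (?\<Phi> -` Z \<inter> space (?L \<Otimes>\<^sub>M lborel))"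
    unfolding lborel_vec_eq_distr_pair[OF h] using meas \<open>compact Z\<close>
    by (simp add: emeasure_distr borel_compact)
  also have "?\<Phi> -` Z \<inter> space (?L \<Otimes>\<^sub>M lborel) = X \<times> {0..1::real}"
  proof -
    have "a + (\<Sum>j<m. ?\<Phi> z $ f j *\<^sub>R b j) = frame_point m a b (fst z)" "?\<Phi> z $ f m = snd z" for z
      by (simp_all add: frame_point_def hf)
    then show ?thesis
      by (auto simp: Z_def X_def space_pair_measure)
  qed
  also have "emeasure (?L \<Otimes>\<^sub>M lborel) (X \<times> {0..1::real}) = emeasure ?L X"
    using lborel.emeasure_pair_measure_Times[OF X, of "{0..1::real}"] by simp
  finally have "measure lebesgue Z = measure ?L X"
    using \<open>compact Z\<close> by (simp add: measure_def borel_compact)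
  moreover have "measure lebesgue (prism S u) = \<bar>det (M u)\<bar> * measure lebesgue Z"
    unfolding prism measure_translation
    using measure_linear_image[of "(*v) (M u)" Z] \<open>compact Z\<close>
    by (simp add: lmeasurable_compact)
  ultimately show ?thesis by (simp add: det X_def)
qed

section \<open>Exchanging two vertices\<close>

lemma linear_image_prism:
  assumes "linear T"
  shows "(\<lambda>x. c + T x) ` prism S u = prism ((\<lambda>x. c + T x) ` S) (T u)"
proof -
  have *: "c + T (x + t *\<^sub>R u) = (c + T x) + t *\<^sub>R T u" for x t
    using assms by (simp add: linear_add linear_scale)
  show ?thesis
  proof (intro equalityI subsetI)
    fix y assume "y \<in> (\<lambda>x. c + T x) ` prism S u"
    then show "y \<in> prism ((\<lambda>x. c + T x) ` S) (T u)"
      unfolding prism_def using * by blast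
  next
    fix y assume "y \<in> prism ((\<lambda>x. c + T x) ` S) (T u)"
    then obtain x t where "x \<in> S" "0 \<le> t" "t \<le> 1" "y = c + T (x + t *\<^sub>R u)"
      unfolding prism_def * by blast
    then show "y \<in> (\<lambda>x. c + T x) ` prism S u"
      unfolding prism_def by blast
  qed
qed

lemma compact_prism:
  fixes S :: "'a::euclidean_space set"
  assumes "compact S" shows "compact (prism S u)"
proof -
  have "compact ((\<lambda>(x, t). x + t *\<^sub>R u) ` (S \<times> {0..1::real}))"
    using assms unfolding case_prod_beta
    by (intro compact_continuous_image continuous_intros compact_Times) auto
  also have "(\<lambda>(x, t). x + t *\<^sub>R u) ` (S \<times> {0..1::real}) = prism S u"
    unfolding prism_def by force
  finally show ?thesis .
qed

text \<open>
  The volume-preserving map is the affine involution that exchanges \<open>p\<close> and \<open>q\<close> and fixes \<open>W\<close>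
  pointwise; as it reverses \<open>p - q\<close>, it exchanges the two prisms.  The covectors \<open>k\<close> and \<open>l\<close> provide
  the affine functional needed to write it down.
\<close>

lemma measure_prism_exchange:
  fixes p q :: "real^'w::{finite,wellorder}"
  assumes W: "finite W"
    and k: "\<And>y. y \<in> W \<Longrightarrow> k \<bullet> (y - q) = 0" "k \<bullet> (p - q) \<noteq> 0"
    and l: "\<And>y. y \<in> W \<Longrightarrow> l \<bullet> (y - p) = 0" "l \<bullet> (q - p) \<noteq> 0"
  shows "measure lebesgue (prism (convex hull (insert q W)) (p - q)) =
         measure lebesgue (prism (convex hull (insert p W)) (q - p))"
proof -
  \<comment> \<open>The map is \<open>x + G x (q - p)\<close> for the affine \<open>G x = 1 - g \<bullet> (p - x)\<close>: \<open>G p = 1\<close>, \<open>G q = - 1\<close>, \<open>G = 0\<close> on \<open>W\<close>.\<close>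
  define g where "g = k /\<^sub>R (k \<bullet> (p - q)) - l /\<^sub>R (l \<bullet> (q - p))"
  define T where "T x = x + (g \<bullet> x) *\<^sub>R (q - p)" for x
  define c where "c = - (g \<bullet> p - 1) *\<^sub>R (q - p)"
  have g: "g \<bullet> (p - q) = 2"
  proof -
    have "l \<bullet> (p - q) = - (l \<bullet> (q - p))" by (simp add: inner_diff_right)
    then show ?thesis using k(2) l(2) by (simp add: g_def inner_diff_left)
  qed
  have gW: "g \<bullet> (p - y) = 1" if "y \<in> W" for y
  proof -
    have "k \<bullet> (p - y) = k \<bullet> (p - q)" "l \<bullet> (p - y) = 0"
      using k(1)[OF that] l(1)[OF that] by (simp_all add: inner_diff_right)
    then show ?thesis using k(2) by (simp add: g_def inner_diff_left)
  qed
  have linT: "linear T"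
    unfolding T_def by (rule linearI) (simp_all add: algebra_simps inner_add_right)
  have aff: "c + T x = x + (1 - g \<bullet> (p - x)) *\<^sub>R (q - p)" for x
    by (simp add: c_def T_def inner_diff_right algebra_simps)
  have vertices: "(\<lambda>x. c + T x) ` insert q W = insert p W"
  proof -
    have "c + T q = p" unfolding aff g by simp
    moreover have "c + T y = y" if "y \<in> W" for y
      unfolding aff gW[OF that] by simp
    ultimately show ?thesis by (auto simp: image_iff)
  qed
  have hull: "(\<lambda>x. c + T x) ` (convex hull (insert q W)) = convex hull (insert p W)"
  proof -
    have "(\<lambda>x. c + T x) ` X = (+) c ` (T ` X)" for X by (simp add: image_image)
    then show ?thesis
      using convex_hull_translation[of c "T ` insert q W"]
        convex_hull_linear_image[OF linT, of "insert q W"] vertices by metis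
  qed
  have Tpq: "T (p - q) = q - p"
    unfolding T_def g by (simp add: algebra_simps scaleR_2)
  \<comment> \<open>An involution has determinant \<open>1\<close> or \<open>- 1\<close>.\<close>
  have "T (T x) = x" for x
  proof -
    have "g \<bullet> (q - p) = - 2" using g by (simp add: inner_diff_right)
    then have "g \<bullet> T x = - (g \<bullet> x)" by (simp add: T_def inner_add_right)
    then show ?thesis unfolding T_def[of "T x"] by (simp add: T_def)
  qed
  then have "matrix T ** matrix T = mat 1"
    by (metis linT matrix_compose matrix_id_mat_1 comp_apply eq_id_iff id_def)
  then have "det (matrix T) * det (matrix T) = 1"
    by (metis det_mul det_I)
  then have "\<bar>det (matrix T)\<bar> = 1"
    by (metis abs_mult abs_mult_self_eq abs_one mult.right_neutral real_sqrt_abs2 real_sqrt_one)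
  moreover have "prism (convex hull (insert q W)) (p - q) \<in> lmeasurable"
    using W by (intro lmeasurable_compact compact_prism finite_imp_compact_convex_hull) auto
  ultimately have "measure lebesgue (prism (convex hull (insert q W)) (p - q)) =
      measure lebesgue ((+) c ` T ` prism (convex hull (insert q W)) (p - q))"
    using measure_linear_image[OF linT] by (simp add: measure_translation)
  also have "(+) c ` T ` prism (convex hull (insert q W)) (p - q) =
      prism (convex hull (insert p W)) (q - p)"
    using linear_image_prism[OF linT, of c "convex hull (insert q W)" "p - q"]
    by (simp add: hull Tpq image_image)
  finally show ?thesis .
qed

text \<open>
  The value that \<^const>\<open>flat_volume\<close> takes when its origin and frame are \<open>a\<close> and \<open>b\<close>.
\<close>

definition frame_volume :: "nat \<Rightarrow> 'a::euclidean_space set \<Rightarrow> 'a \<Rightarrow> (nat \<Rightarrow> 'a) \<Rightarrow> real" where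
  "frame_volume m S a b =
    measure (\<Pi>\<^sub>M j\<in>{..<m}. lborel) {x \<in> space (\<Pi>\<^sub>M j\<in>{..<m}. lborel). frame_point m a b x \<in> S}"

lemma flat_volume_frame:
  assumes "flat_frame m S a0 b0"
  obtains a b where "flat_frame m S a b" "flat_volume m S = frame_volume m S a b"
proof -
  define ab where "ab = (SOME (a, b). flat_frame m S a b)"
  obtain a b where ab: "ab = (a, b)" by (cases ab)
  have "case ab of (a, b) \<Rightarrow> flat_frame m S a b"
    unfolding ab_def by (rule someI[of _ "(a0, b0)"]) (simp add: assms)
  moreover have "flat_volume m S = frame_volume m S a b"
    using ab by (simp add: flat_volume_def frame_volume_def ab_def[symmetric] Let_def)
  ultimately show thesis using that ab by auto
qed

lemma inner_normal_eq_measure_prism: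
  fixes p q :: "real^'w::{finite,wellorder}"
  assumes card: "CARD('w) = Suc m" and W: "finite W"
    and fr: "flat_frame m (convex hull (insert q W)) a b"
    and k: "norm k = frame_volume m (convex hull (insert q W)) a b" "k \<noteq> 0"
      "\<And>j. j < m \<Longrightarrow> k \<bullet> b j = 0"
  shows "\<bar>k \<bullet> u\<bar> = measure lebesgue (prism (convex hull (insert q W)) u)"
proof -
  let ?S = "convex hull (insert q W)"
  have "compact ?S" using W by (intro finite_imp_compact_convex_hull) auto
  moreover have "norm (k /\<^sub>R norm k) = 1" using k(2) by simp
  ultimately have "measure lebesgue (prism ?S u) =
      frame_volume m ?S a b * \<bar>(k /\<^sub>R norm k) \<bullet> u\<bar>"
    unfolding frame_volume_def using k(3) fr card by (intro measure_prism) auto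
  also have "\<dots> = norm k * \<bar>(k /\<^sub>R norm k) \<bullet> u\<bar>" by (simp only: k(1))
  also have "\<dots> = \<bar>norm k * ((k /\<^sub>R norm k) \<bullet> u)\<bar>"
    by (simp add: abs_mult)
  also have "norm k * ((k /\<^sub>R norm k) \<bullet> u) = k \<bullet> u"
    using k(2) by simp
  finally show ?thesis by simp
qed

lemma frame_isometry:
  fixes \<tau> :: "'a::euclidean_space \<Rightarrow> 'b::euclidean_space"
  assumes "linear \<tau>" and iso: "\<And>x. norm (\<tau> x) = norm x"
  shows "\<tau> x \<bullet> \<tau> y = x \<bullet> y"
    and "frame_point m (\<tau> a) (\<tau> \<circ> b) = \<tau> \<circ> frame_point m a b"
    and "flat_frame m S a b \<Longrightarrow> flat_frame m (\<tau> ` S) (\<tau> a) (\<tau> \<circ> b)"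
    and "frame_volume m (\<tau> ` S) (\<tau> a) (\<tau> \<circ> b) = frame_volume m S a b"
proof -
  interpret linear \<tau> by fact
  show inner: "\<tau> x \<bullet> \<tau> y = x \<bullet> y" for x y
    using iso by (simp add: dot_norm add[symmetric])
  show fp: "frame_point m (\<tau> a) (\<tau> \<circ> b) = \<tau> \<circ> frame_point m a b"
    by (rule ext) (simp add: frame_point_def add sum scaleR)
  show "flat_frame m S a b \<Longrightarrow> flat_frame m (\<tau> ` S) (\<tau> a) (\<tau> \<circ> b)"
    unfolding flat_frame_def fp by (auto simp: inner)
  have "inj \<tau>"
    by (metis iso norm_eq_zero injI diff eq_iff_diff_eq_0)
  then show "frame_volume m (\<tau> ` S) (\<tau> a) (\<tau> \<circ> b) = frame_volume m S a b"
    unfolding frame_volume_def fp by (simp add: inj_image_mem_iff)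
qed

text \<open>
  Both sides are the volume of the same prism up to the exchange of \<open>p\<close> and \<open>q\<close>.  The configuration is
  first carried by an isometry to a space whose coordinates are well-ordered, where the change of
  variables formula for linear maps applies.
\<close>

lemma inner_normals_swap_isometry:
  fixes p q :: "'a::euclidean_space" and \<tau> :: "'a \<Rightarrow> real^'w::{finite,wellorder}"
  assumes iso: "linear \<tau>" "\<And>x. norm (\<tau> x) = norm x"
    and card: "CARD('w) = Suc m" and W: "finite W"
    and fk: "flat_frame m (convex hull (insert q W)) a b"
    and k: "norm k = frame_volume m (convex hull (insert q W)) a b"
      "\<And>j. j < m \<Longrightarrow> k \<bullet> b j = 0" 
      "\<And>y. y \<in> W \<Longrightarrow> k \<bullet> (y - q) = 0" "k \<bullet> (p - q) \<noteq> 0"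
    and fl: "flat_frame m (convex hull (insert p W)) c d"
    and l: "norm l = frame_volume m (convex hull (insert p W)) c d"
      "\<And>j. j < m \<Longrightarrow> l \<bullet> d j = 0" 
      "\<And>y. y \<in> W \<Longrightarrow> l \<bullet> (y - p) = 0" "l \<bullet> (q - p) \<noteq> 0"
  shows "\<bar>k \<bullet> (p - q)\<bar> = \<bar>l \<bullet> (q - p)\<bar>"
proof -
  note fr = frame_isometry[OF iso]
  have hull: "\<tau> ` (convex hull (insert x W)) = convex hull (insert (\<tau> x) (\<tau> ` W))" for x
    using convex_hull_linear_image[OF iso(1)] by simp
  have inner: "\<tau> x \<bullet> (\<tau> y - \<tau> z) = x \<bullet> (y - z)" for x y z
    by (simp add: inner_diff_right fr(1))
  have volume: "frame_volume m (convex hull (insert (\<tau> x) (\<tau> ` W))) (\<tau> a) (\<tau> \<circ> b) =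
      frame_volume m (convex hull (insert x W)) a b" for x a b
    using fr(4) unfolding hull[symmetric] .
  have "\<bar>\<tau> k \<bullet> (\<tau> p - \<tau> q)\<bar> =
      measure lebesgue (prism (convex hull (insert (\<tau> q) (\<tau> ` W))) (\<tau> p - \<tau> q))"
  proof (rule inner_normal_eq_measure_prism[OF card, of _ _ "\<tau> a" "\<tau> \<circ> b"])
    show "\<tau> k \<noteq> 0" using iso(2)[of k] k(4) by auto
  qed (use W k fr(3)[OF fk] in \<open>auto simp: iso volume hull fr(1)\<close>)
  also have "\<dots> = measure lebesgue (prism (convex hull (insert (\<tau> p) (\<tau> ` W))) (\<tau> q - \<tau> p))"
    using W k l by (intro measure_prism_exchange[where k="\<tau> k" and l="\<tau> l"]) (auto simp: inner)
  also have "\<dots> = \<bar>\<tau> l \<bullet> (\<tau> q - \<tau> p)\<bar>"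
  proof (rule inner_normal_eq_measure_prism[OF card, of _ _ "\<tau> c" "\<tau> \<circ> d", symmetric])
    show "\<tau> l \<noteq> 0" using iso(2)[of l] l(4) by auto
  qed (use W l fr(3)[OF fl] in \<open>auto simp: iso volume hull fr(1)\<close>)
  finally show ?thesis by (simp add: inner)
qed

lemma linear_isometry_exists:
  assumes "DIM('a::euclidean_space) = DIM('b::euclidean_space)"
  shows "\<exists>\<tau> :: 'a \<Rightarrow> 'b. linear \<tau> \<and> (\<forall>x. norm (\<tau> x) = norm x)"
proof -
  obtain f :: "'a \<Rightarrow> 'b" where "linear f" "\<And>x. x \<in> UNIV \<Longrightarrow> norm (f x) = norm x"
    using isometry_subset_subspace[of "UNIV :: 'a set" "UNIV :: 'b set"] assms by auto
  then show ?thesis by auto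
qed

lemma inner_normals_swap:
  fixes p q :: "real^'n"
  assumes n: "CARD('n) \<le> 3" and card: "CARD('n) = Suc m" and W: "finite W"
    and fk: "flat_frame m (convex hull (insert q W)) a b"
    and k: "norm k = frame_volume m (convex hull (insert q W)) a b"
      "\<And>j. j < m \<Longrightarrow> k \<bullet> b j = 0" 
      "\<And>y. y \<in> W \<Longrightarrow> k \<bullet> (y - q) = 0" "k \<bullet> (p - q) \<noteq> 0"
    and fl: "flat_frame m (convex hull (insert p W)) c d"
    and l: "norm l = frame_volume m (convex hull (insert p W)) c d"
      "\<And>j. j < m \<Longrightarrow> l \<bullet> d j = 0" 
      "\<And>y. y \<in> W \<Longrightarrow> l \<bullet> (y - p) = 0" "l \<bullet> (q - p) \<noteq> 0"
  shows "\<bar>k \<bullet> (p - q)\<bar> = \<bar>l \<bullet> (q - p)\<bar>"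
proof -
  note balanced = inner_normals_swap_isometry[OF _ _ _ W fk k fl l]
  have "m = 0 \<or> m = 1 \<or> m = 2" using n card by auto
  then show ?thesis
    using linear_isometry_exists[where 'a="real^'n" and 'b="real^1"]
      linear_isometry_exists[where 'a="real^'n" and 'b="real^2"]
      linear_isometry_exists[where 'a="real^'n" and 'b="real^3"]
      balanced[where 'w=1] balanced[where 'w=2] balanced[where 'w=3]
    by (auto simp: card)
qed

section \<open>Symmetric matrices against rotations in dimension at most three\<close>

lemma symmetric_inner:
  fixes A :: "real^'n^'n"
  assumes "transpose A = A"
  shows "x \<bullet> (A *v y) = (A *v x) \<bullet> y"
  using dot_lmul_matrix[of x A y] assms by (metis transpose_matrix_vector)

text \<open>
  A maximizer of \<open>x \<bullet> A x\<close> on the unit sphere is an eigenvector: with the maximum \<open>\<mu>\<close>, the form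
  \<open>\<mu> (x \<bullet> x) - x \<bullet> A x\<close> is positive semidefinite and vanishes at \<open>w\<close>, so its derivative there vanishes.
\<close>

lemma max_eigenvector:
  fixes A :: "real^'n^'n"
  assumes sym: "transpose A = A"
  obtains w \<mu> where "w \<noteq> 0" "A *v w = \<mu> *\<^sub>R w" "\<And>x. x \<bullet> (A *v x) \<le> \<mu> * (x \<bullet> x)"
proof -
  have "\<exists>w\<in>sphere 0 1. \<forall>x\<in>sphere 0 1. x \<bullet> (A *v x) \<le> w \<bullet> (A *v w)"
    by (intro continuous_attains_sup continuous_intros)
      (auto intro: linear_continuous_on simp: sphere_eq_empty)
  then obtain w where w: "norm w = 1" and
    max: "\<And>x. norm x = 1 \<Longrightarrow> x \<bullet> (A *v x) \<le> w \<bullet> (A *v w)"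
    by auto
  define \<mu> where "\<mu> = w \<bullet> (A *v w)"
  have le: "x \<bullet> (A *v x) \<le> \<mu> * (x \<bullet> x)" for x
  proof (cases "x = 0")
    case False
    have "(x /\<^sub>R norm x) \<bullet> (A *v (x /\<^sub>R norm x)) \<le> \<mu>"
      unfolding \<mu>_def using False by (intro max) simp
    then have "(x \<bullet> (A *v x)) / (norm x)\<^sup>2 \<le> \<mu>"
      by (simp add: matrix_vector_mult_scaleR power2_eq_square divide_inverse algebra_simps)
    then show ?thesis
      using False by (simp add: divide_le_eq power2_norm_eq_inner)
  qed simp
  define y where "y = \<mu> *\<^sub>R w - A *v w"
  define B where "B = \<mu> * (y \<bullet> y) - y \<bullet> (A *v y)"
  have "B \<ge> 0" using le[of y] by (simp add: B_def)
  have quad: "0 \<le> 2 * t * (y \<bullet> y) + t\<^sup>2 * B" for t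
  proof -
    have "w \<bullet> w = 1" using w by (simp add: norm_eq_1)
    have yy: "y \<bullet> y = \<mu> * (w \<bullet> y) - y \<bullet> (A *v w)"
    proof -
      have "y \<bullet> y = y \<bullet> (\<mu> *\<^sub>R w - A *v w)" by (simp add: y_def)
      then show ?thesis by (simp add: inner_diff_right inner_commute[of y w])
    qed
    have "w \<bullet> (A *v y) = y \<bullet> (A *v w)"
      using symmetric_inner[OF sym, of w y] by (simp add: inner_commute)
    then have e1: "(w + t *\<^sub>R y) \<bullet> (A *v (w + t *\<^sub>R y)) =
        \<mu> + 2 * t * (y \<bullet> (A *v w)) + t\<^sup>2 * (y \<bullet> (A *v y))"
      by (simp add: matrix_vector_right_distrib matrix_vector_mult_scaleR inner_add_left
          inner_add_right \<mu>_def power2_eq_square algebra_simps)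
    have e2: "(w + t *\<^sub>R y) \<bullet> (w + t *\<^sub>R y) = 1 + 2 * t * (w \<bullet> y) + t\<^sup>2 * (y \<bullet> y)"
      using \<open>w \<bullet> w = 1\<close>
      by (simp add: inner_add_left inner_add_right inner_commute[of y w] power2_eq_square algebra_simps)
    have "2 * t * (y \<bullet> y) = 2 * t * \<mu> * (w \<bullet> y) - 2 * t * (y \<bullet> (A *v w))"
      unfolding yy by (simp add: algebra_simps)
    then have "\<mu> * ((w + t *\<^sub>R y) \<bullet> (w + t *\<^sub>R y)) - (w + t *\<^sub>R y) \<bullet> (A *v (w + t *\<^sub>R y))
        = 2 * t * (y \<bullet> y) + t\<^sup>2 * B"
      unfolding e1 e2 B_def by (simp add: algebra_simps)
    then show ?thesis using le[of "w + t *\<^sub>R y"] by linarith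
  qed
  have "y = 0"
  proof (rule ccontr)
    assume "y \<noteq> 0"
    then have c: "y \<bullet> y > 0" by simp
    \<comment> \<open>Moving from \<open>w\<close> by \<open>- t y\<close>, small enough for the linear term to win, would make the form negative.\<close>
    define t where "t = (y \<bullet> y) / (B + 1)"
    have t: "t > 0" "t * B \<le> y \<bullet> y"
      using c \<open>B \<ge> 0\<close> by (auto simp: t_def field_simps)
    have "2 * (-t) * (y \<bullet> y) + (-t)\<^sup>2 * B = t * (t * B - 2 * (y \<bullet> y))"
      by (simp add: power2_eq_square algebra_simps)
    also have "\<dots> < 0"
    proof (rule mult_pos_neg)
      show "t * B - 2 * (y \<bullet> y) < 0" using t(2) c by linarith
    qed (rule t)
    finally show False using quad[of "-t"] by linarith
  qed
  show thesis
  proof (rule that)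
    show "w \<noteq> 0" using w by auto
    show "A *v w = \<mu> *\<^sub>R w" using \<open>y = 0\<close> by (simp add: y_def)
  qed (rule le)
qed

lemma trace_symmetric_mult_transpose:
  fixes A X :: "real^'n^'n"
  assumes "transpose A = A"
  shows "trace (A ** transpose X) = trace (A ** X)"
proof -
  have "trace (transpose (A ** transpose X)) = trace (X ** A)"
    by (simp add: matrix_transpose_mul assms)
  also have "\<dots> = trace (A ** X)" by (rule trace_mul_sym)
  finally show ?thesis by (simp add: trace_def transpose_def)
qed

lemma matrix_scaleR_left: "(c *\<^sub>R (A :: real^'n^'m)) ** B = c *\<^sub>R (A ** B)"
  by (simp add: matrix_matrix_mult_def vec_eq_iff sum_distrib_left mult.assoc)

lemma matrix_scaleR_right: "(A :: real^'n^'m) ** (c *\<^sub>R B) = c *\<^sub>R (A ** B)"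
  by (simp add: matrix_matrix_mult_def vec_eq_iff sum_distrib_left mult.left_commute)

lemma matrix_add_rdistrib: "((A :: real^'n^'m) + B) ** C = A ** C + B ** C"
  by (simp add: matrix_matrix_mult_def vec_eq_iff distrib_right sum.distrib)

lemma matrix_minus_left: "(- (A :: real^'n^'m)) ** B = - (A ** B)"
  by (simp add: matrix_matrix_mult_def vec_eq_iff sum_negf)

lemma matrix_minus_right: "(A :: real^'n^'m) ** (- B) = - (A ** B)"
  by (simp add: matrix_matrix_mult_def vec_eq_iff sum_negf)

lemma matrix_diff_ldistrib: "(A :: real^'n^'m) ** (B - C) = A ** B - A ** C"
  by (simp add: matrix_matrix_mult_def vec_eq_iff right_diff_distrib sum_subtractf)

lemma matrix_diff_rdistrib: "((A :: real^'n^'m) - B) ** C = A ** C - B ** C"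
  by (simp add: matrix_matrix_mult_def vec_eq_iff left_diff_distrib sum_subtractf)

lemmas matrix_ring_simps =
  matrix_add_ldistrib matrix_add_rdistrib matrix_diff_ldistrib matrix_diff_rdistrib
  matrix_scaleR_left matrix_scaleR_right matrix_minus_left matrix_minus_right

text \<open>
  For a skew \<open>3 \<times> 3\<close> matrix this is the squared length of its axial vector.
\<close>

definition half_square_sum :: "real^'n^'n \<Rightarrow> real" where
  "half_square_sum S = (\<Sum>r\<in>UNIV. \<Sum>c\<in>UNIV. (S $ r $ c)\<^sup>2) / 2"

lemma UNIV_at_most_3:
  assumes "CARD('n) \<le> 3"
  obtains x :: "'n::finite" where "UNIV = {x}"
  | x y :: "'n::finite" where "x \<noteq> y" "UNIV = {x, y}"
  | x y z :: "'n::finite" where "x \<noteq> y" "x \<noteq> z" "y \<noteq> z" "UNIV = {x, y, z}"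
proof -
  have "CARD('n) = 1 \<or> CARD('n) = 2 \<or> CARD('n) = 3"
    using assms zero_less_card_finite[where 'a='n] by linarith
  then show thesis
    using that by (auto simp: card_1_singleton_iff card_2_iff card_3_iff)
qed

lemma skew_entries:
  fixes S :: "real^'n^'n"
  assumes "transpose S = - S"
  shows "S $ x $ x = 0" "S $ y $ x = - (S $ x $ y)"
proof -
  have *: "S $ y $ x = - (S $ x $ y)" for x y
    using arg_cong[OF assms, of "\<lambda>M. M $ x $ y"] by (simp add: transpose_def)
  show "S $ x $ x = 0" using *[of x x] by simp
  show "S $ y $ x = - (S $ x $ y)" by (rule *)
qed

text \<open>
  In dimension three this is the Cayley-Hamilton identity, trace and determinant of a skew matrix being
  zero; in smaller dimensions already \<open>S\<^sup>2\<close> is a multiple of the identity.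
\<close>

lemma skew_cube:
  fixes S :: "real^'n^'n"
  assumes "CARD('n) \<le> 3" and skew: "transpose S = - S"
  shows "S ** S ** S = - half_square_sum S *\<^sub>R S"
  using assms(1)
proof (cases rule: UNIV_at_most_3)
  case (1 x)
  have "S $ r $ c = 0" for r c
    using skew_entries(1)[OF skew, of x] 1 by (metis UNIV_I singletonD)
  then show ?thesis by (simp add: vec_eq_iff matrix_matrix_mult_def)
next
  case (2 x y)
  then have univ: "(\<forall>r. P r) \<longleftrightarrow> P x \<and> P y" for P by (metis UNIV_I insertE singletonD)
  show ?thesis
    using 2(1) by (simp add: vec_eq_iff univ matrix_matrix_mult_def half_square_sum_def 2(2)
      skew_entries(1)[OF skew] skew_entries(2)[OF skew, of y x] power2_eq_square algebra_simps)
next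
  case (3 x y z)
  then have univ: "(\<forall>r. P r) \<longleftrightarrow> P x \<and> P y \<and> P z" for P by (metis UNIV_I insertE singletonD)
  show ?thesis
    using 3(1-3) by (simp add: vec_eq_iff univ matrix_matrix_mult_def half_square_sum_def 3(4)
      skew_entries(1)[OF skew] skew_entries(2)[OF skew, of y x] skew_entries(2)[OF skew, of z x]
      skew_entries(2)[OF skew, of z y] power2_eq_square field_simps)
qed

text \<open>
  In dimension three \<open>S\<^sup>2 = w w\<^sup>T - (w \<bullet> w) I\<close> for the axial vector \<open>w\<close>; in dimension two \<open>S\<^sup>2\<close> is a
  negative multiple of the identity; in dimension one there is no nonzero \<open>S\<close>.
\<close>

lemma trace_skew_square_neg:
  fixes A S :: "real^'n^'n"
  assumes "CARD('n) \<le> 3" and skew: "transpose S = - S" and "S \<noteq> 0"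
    and tr: "trace A > 0"
    and A: "\<And>w. CARD('n) = 3 \<Longrightarrow> w \<noteq> 0 \<Longrightarrow> w \<bullet> (A *v w) < trace A * (w \<bullet> w)"
  shows "trace (A ** (S ** S)) < 0"
  using assms(1)
proof (cases rule: UNIV_at_most_3)
  case (1 x)
  have "S $ r $ c = 0" for r c
    using skew_entries(1)[OF skew, of x] 1 by (metis UNIV_I singletonD)
  then have "S = 0" by (simp add: vec_eq_iff)
  then show ?thesis using \<open>S \<noteq> 0\<close> by simp
next
  case (2 x y)
  then have univ: "(\<forall>r. P r) \<longleftrightarrow> P x \<and> P y" for P by (metis UNIV_I insertE singletonD)
  note entries = skew_entries(1)[OF skew] skew_entries(2)[OF skew, of y x]
  have "trace (A ** (S ** S)) = - (trace A * (S $ x $ y)\<^sup>2)"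
    using 2(1) by (simp add: trace_def matrix_matrix_mult_def 2(2) entries power2_eq_square algebra_simps)
  moreover have "S $ x $ y \<noteq> 0"
    using \<open>S \<noteq> 0\<close> by (simp add: vec_eq_iff univ entries)
  ultimately show ?thesis using tr by simp
next
  case (3 x y z)
  then have univ: "(\<forall>r. P r) \<longleftrightarrow> P x \<and> P y \<and> P z" for P by (metis UNIV_I insertE singletonD)
  note entries = skew_entries(1)[OF skew] skew_entries(2)[OF skew, of y x]
    skew_entries(2)[OF skew, of z x] skew_entries(2)[OF skew, of z y]
  \<comment> \<open>the axial vector of \<open>S\<close>, up to sign\<close>
  define w :: "real^'n" where
    "w = (\<chi> r. if r = x then S $ y $ z else if r = y then - (S $ x $ z) else S $ x $ y)"
  have w: "w $ x = S $ y $ z" "w $ y = - (S $ x $ z)" "w $ z = S $ x $ y"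
    using 3(1-3) by (auto simp: w_def)
  have "trace (A ** (S ** S)) = w \<bullet> (A *v w) - trace A * (w \<bullet> w)"
    using 3(1-3) by (simp add: trace_def matrix_matrix_mult_def matrix_vector_mult_def inner_vec_def
      3(4) entries w algebra_simps)
  moreover have "w \<noteq> 0"
    using \<open>S \<noteq> 0\<close> by (auto simp: vec_eq_iff univ entries w)
  moreover have "CARD('n) = 3" unfolding 3(4) using 3(1-3) by simp
  ultimately show ?thesis using A[of w] by simp
qed

lemma transpose_add: "transpose (A + B :: real^'n^'m) = transpose A + transpose B"
  by (simp add: transpose_def vec_eq_iff)

lemma transpose_diff: "transpose (A - B :: real^'n^'m) = transpose A - transpose B"
  by (simp add: transpose_def vec_eq_iff)

lemma trace_scaleR: "trace (c *\<^sub>R (A :: real^'n^'n)) = c * trace A"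
  by (simp add: trace_def sum_distrib_left)

text \<open>
  The transform is \<open>S = (R - I) (R + I)\<^sup>-\<^sup>1\<close>.  It is skew because
  \<open>(R + I)\<^sup>T (R - I) = R - R\<^sup>T\<close> is.
\<close>

lemma cayley_transform:
  fixes R :: "real^'n^'n"
  assumes R: "orthogonal_matrix R" and det: "det (R + mat 1) \<noteq> 0"
  obtains S where "transpose S = - S" "S ** (R + mat 1) = R - mat 1"
    "S ** R = R ** S" "S ** transpose R = transpose R ** S"
proof -
  let ?T = "transpose R"
  let ?P = "R + mat 1" and ?D = "R - mat 1"
  have TR: "?T ** R = mat 1" "R ** ?T = mat 1"
    using R by (auto simp: orthogonal_matrix_def)
  obtain V where V: "?P ** V = mat 1" "V ** ?P = mat 1"
    using det invertible_det_nz[of ?P] by (auto simp: invertible_def)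
  define S where "S = ?D ** V"
  have SP: "S ** ?P = ?D"
    by (simp add: S_def matrix_mul_assoc[symmetric] V)
  have cancel: "X = Y" if "X ** ?P = Y ** ?P" for X Y :: "real^'n^'n"
    using that V by (metis matrix_mul_assoc matrix_mul_rid)
  have PD: "?P ** ?D = ?D ** ?P"
    by (simp add: matrix_ring_simps)
  have "?P ** S ** ?P = ?P ** ?D"
    by (simp add: matrix_mul_assoc[symmetric] SP)
  also have "\<dots> = S ** ?P ** ?P"
    by (simp add: PD SP)
  finally have "?P ** S = S ** ?P" by (rule cancel)
  then have RS: "R ** S = S ** R"
    by (simp add: matrix_ring_simps)
  have "?T ** S = ?T ** (S ** R) ** ?T"
    by (simp add: matrix_mul_assoc[symmetric] TR)
  also have "\<dots> = S ** ?T"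
    by (simp add: RS[symmetric] matrix_mul_assoc TR)
  finally have TS: "?T ** S = S ** ?T" .
  have "transpose S ** ?P = - S ** ?P"
  proof -
    have "transpose ?P ** (transpose S ** ?P) = transpose (S ** ?P) ** ?P"
      by (simp add: matrix_transpose_mul matrix_mul_assoc)
    also have "\<dots> = - (transpose ?P ** ?D)"
      unfolding SP by (simp add: transpose_add transpose_diff matrix_ring_simps TR)
    also have "\<dots> = transpose ?P ** (- S ** ?P)"
      by (simp only: SP matrix_minus_left matrix_minus_right)
    finally have "transpose V ** (transpose ?P ** (transpose S ** ?P)) =
        transpose V ** (transpose ?P ** (- S ** ?P))" by simp
    moreover have "transpose V ** transpose ?P = mat 1"
      by (metis V(1) matrix_transpose_mul transpose_mat)
    then have "transpose V ** (transpose ?P ** X) = X" for X :: "real^'n^'n"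
      by (metis matrix_mul_assoc matrix_mul_lid)
    ultimately show ?thesis by simp
  qed
  then have "transpose S = - S" by (rule cancel)
  then show thesis using that[of S] SP RS TS by simp
qed

text \<open>
  Let \<open>Q = 2 I - R - R\<^sup>T\<close>, so that \<open>tr (A Q) = - 2 tr (A (R - I))\<close> by symmetry of \<open>A\<close>.  From
  \<open>Q = (R - I) (R - I)\<^sup>T\<close> and \<open>R - I = S (R + I)\<close> comes \<open>Q = - S (4 I - Q) S\<close>, which \<open>S\<^sup>3 = - s S\<close> and
  the commutation of \<open>Q\<close> and \<open>S\<close> solve to \<open>(1 + s) Q = - 4 S\<^sup>2\<close>.
\<close>

lemma trace_rotation_defect_neg:
  fixes A R :: "real^'n^'n"
  assumes n: "CARD('n) \<le> 3" and R: "orthogonal_matrix R" "det (R + mat 1) \<noteq> 0" "R \<noteq> mat 1"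
    and sym: "transpose A = A" and tr: "trace A > 0"
    and A: "\<And>w. CARD('n) = 3 \<Longrightarrow> w \<noteq> 0 \<Longrightarrow> w \<bullet> (A *v w) < trace A * (w \<bullet> w)"
  shows "trace (A ** (R - mat 1)) < 0"
proof -
  obtain S where skew: "transpose S = - S" and SP: "S ** (R + mat 1) = R - mat 1"
    and comm: "S ** R = R ** S" "S ** transpose R = transpose R ** S"
    using cayley_transform[OF R(1,2)] by blast
  define Q where "Q = 2 *\<^sub>R mat 1 - R - transpose R"
  define s where "s = half_square_sum S"
  have s: "1 + s > 0"
    unfolding s_def half_square_sum_def by (simp add: add_pos_nonneg sum_nonneg)
  have TR: "transpose R ** R = mat 1" "R ** transpose R = mat 1"
    using R(1) by (auto simp: orthogonal_matrix_def)
  have cube: "S ** S ** S = - s *\<^sub>R S"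
    unfolding s_def by (rule skew_cube[OF n skew])
  have QS: "S ** Q = Q ** S"
    by (simp add: Q_def matrix_ring_simps comm)
  have "Q = (R - mat 1) ** transpose (R - mat 1)"
    by (simp add: Q_def transpose_diff matrix_ring_simps TR scaleR_2)
  also have "\<dots> = - (S ** ((R + mat 1) ** transpose (R + mat 1)) ** S)"
    by (simp add: SP[symmetric] matrix_transpose_mul skew matrix_mul_assoc matrix_minus_right)
  also have "(R + mat 1) ** transpose (R + mat 1) = 4 *\<^sub>R mat 1 - Q"
    by (simp add: Q_def transpose_add matrix_ring_simps TR vec_eq_iff)
  also have "- (S ** (4 *\<^sub>R mat 1 - Q) ** S) = Q ** S ** S - 4 *\<^sub>R (S ** S)"
    by (simp add: matrix_ring_simps QS)
  finally have Q: "Q = Q ** S ** S - 4 *\<^sub>R (S ** S)" .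
  have "Q ** S = Q ** (S ** S ** S) - 4 *\<^sub>R (S ** S ** S)"
    by (subst Q) (simp add: matrix_ring_simps matrix_mul_assoc)
  then have "(1 + s) *\<^sub>R (Q ** S) = (4 * s) *\<^sub>R S"
    unfolding cube by (simp add: matrix_ring_simps algebra_simps)
  then have "(1 + s) *\<^sub>R (Q ** S ** S) = (4 * s) *\<^sub>R (S ** S)"
    by (metis matrix_scaleR_left)
  then have "(1 + s) *\<^sub>R Q = - 4 *\<^sub>R (S ** S)"
    by (subst Q) (simp add: scaleR_diff_right algebra_simps)
  then have "(1 + s) * trace (A ** Q) = - 4 * trace (A ** (S ** S))"
    by (metis matrix_scaleR_right trace_scaleR)
  moreover have "trace (A ** (S ** S)) < 0"
  proof (rule trace_skew_square_neg[OF n skew _ tr A])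
    show "S \<noteq> 0" using SP R(3) by auto
  qed
  ultimately have "trace (A ** Q) > 0"
    using s by (metis mult_neg_neg neg_less_0_iff_less zero_less_mult_pos zero_less_numeral)
  moreover have "trace (A ** Q) = - 2 * trace (A ** (R - mat 1))"
    using trace_symmetric_mult_transpose[OF sym, of R]
    by (simp add: Q_def matrix_ring_simps trace_sub trace_scaleR)
  ultimately show ?thesis by simp
qed

section \<open>Facet normals of a simplex\<close>

lemma flat_frame_exists:
  assumes "aff_dim S = int m" "S \<noteq> {}"
  shows "\<exists>a b. flat_frame m S a b"
proof -
  obtain s where s: "s \<in> S" using assms(2) by auto
  let ?D = "(+) (- s) ` S"
  have dim: "dim (span ?D) = m"
    using aff_dim_eq_dim[OF hull_inc[OF s]] assms(1) by (simp add: dim_span)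
  obtain B where B: "pairwise orthogonal B" "\<And>x. x \<in> B \<Longrightarrow> norm x = 1"
      "independent B" "card B = m" "span B = span ?D"
    using orthonormal_basis_subspace[OF subspace_span, of ?D] dim by metis
  have finB: "finite B" using B(3) by (rule independent_imp_finite)
  then obtain b where b: "bij_betw b {..<m} B"
    using ex_bij_betw_nat_finite[OF finB] B(4) by (auto simp: atLeast0LessThan)
  have orth: "b i \<bullet> b j = (if i = j then 1 else 0)" if "i < m" "j < m" for i j
  proof -
    have mem: "b i \<in> B" "b j \<in> B" using that b by (auto dest: bij_betwE)
    have "i \<noteq> j \<Longrightarrow> b i \<noteq> b j"
      using that b by (auto simp: bij_betw_def inj_on_def)
    then show ?thesis
      using mem B(1,2) by (auto simp: pairwise_def orthogonal_def norm_eq_1)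
  qed
  have "y \<in> range (frame_point m s b)" if "y \<in> S" for y
  proof -
    have "y - s \<in> span B"
      unfolding B(5) using that by (intro span_base) (auto simp: image_iff)
    then obtain u where "y - s = (\<Sum>x\<in>B. u x *\<^sub>R x)"
      using finB by (auto simp: span_finite)
    also have "\<dots> = (\<Sum>j<m. u (b j) *\<^sub>R b j)"
      by (rule sum.reindex_bij_betw[OF b, symmetric])
    finally have "y = frame_point m s b (\<lambda>j. u (b j))"
      by (simp add: frame_point_def algebra_simps)
    then show ?thesis by blast
  qed
  then show ?thesis using orth unfolding flat_frame_def by blast
qed

text \<open>
  A frame of the right length spans exactly the directions of the flat set, so a normal of the set is
  orthogonal to the frame.
\<close>

lemma flat_frame_normal:
  assumes fr: "flat_frame m S a b" and dim: "aff_dim S = int m" and "S \<noteq> {}"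
    and k: "\<And>x y. x \<in> S \<Longrightarrow> y \<in> S \<Longrightarrow> k \<bullet> (y - x) = 0" and "j < m"
  shows "k \<bullet> b j = 0"
proof -
  obtain s where s: "s \<in> S" using assms(3) by auto
  let ?D = "(+) (- s) ` S" and ?B = "b ` {..<m}"
  have "dim ?D = m"
    using aff_dim_eq_dim[OF hull_inc[OF s]] dim by simp
  moreover have "dim ?B \<le> m"
    using dim_le_card'[of ?B] card_image_le[of "{..<m}" b] by simp
  moreover have sub: "?D \<subseteq> span ?B"
  proof
    fix d assume "d \<in> ?D"
    then obtain y where y: "y \<in> S" "d = y - s" by auto
    obtain f where f: "frame_point m a b f = y" using flat_frame_point[OF fr y(1)] .
    obtain g where g: "frame_point m a b g = s" using flat_frame_point[OF fr s] .
    have "d = (\<Sum>j<m. f j *\<^sub>R b j) - (\<Sum>j<m. g j *\<^sub>R b j)"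
      by (simp add: y(2) f[symmetric] g[symmetric] frame_point_def)
    also have "\<dots> \<in> span ?B"
      by (intro span_diff span_sum span_scale span_base) auto
    finally show "d \<in> span ?B" .
  qed
  ultimately have "span ?D = span (span ?B)"
    by (intro dim_eq_span) (simp_all add: dim_span)
  then have "b j \<in> span ?D"
    using \<open>j < m\<close> by (simp add: span_base)
  moreover have "orthogonal k d" if "d \<in> ?D" for d
    using that k[OF s] by (auto simp: orthogonal_def)
  ultimately have "orthogonal k (b j)"
    using orthogonal_to_span by blast
  then show ?thesis by (simp add: orthogonal_def)
qed

lemma simplex_affine_hull:
  fixes v :: "'n::finite option \<Rightarrow> real^'n"
  assumes "ordered_simplex v"
  shows "affine hull (range v) = UNIV"
  using assms
  by (intro affine_independent_span_eq) (auto simp: ordered_simplex_def card_image card_UNIV_option)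

lemma vector_as_edge_combination:
  fixes v :: "'i::finite \<Rightarrow> 'a::real_vector"
  assumes "affine hull (range v) = UNIV" "inj v"
  obtains u where "w = (\<Sum>j\<in>UNIV. u j *\<^sub>R (v j - v q))"
proof -
  have "w + v q \<in> affine hull (range v)" using assms by simp
  then obtain u where u: "sum u (range v) = 1" "(\<Sum>x\<in>range v. u x *\<^sub>R x) = w + v q"
    by (auto simp: affine_hull_finite)
  have "sum (u \<circ> v) UNIV = 1" "(\<Sum>j\<in>UNIV. u (v j) *\<^sub>R v j) = w + v q"
    using u assms(2) by (simp_all add: sum.reindex)
  then have "w = (\<Sum>j\<in>UNIV. u (v j) *\<^sub>R (v j - v q))"
    by (simp add: scaleR_diff_right sum_subtractf scaleR_sum_left[symmetric])
  then show thesis by (rule that)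
qed

lemma vertex_in_face: "j \<noteq> i \<Longrightarrow> v j \<in> face v i"
  by (simp add: face_def hull_inc)

text \<open>
  An interior point \<open>y\<close> is a convex combination of the vertices, so for a vertex \<open>v\<^sub>j\<close> of facet \<open>i\<close> the
  number \<open>k \<bullet> (y - v\<^sub>j) < 0\<close> is a nonnegative multiple of \<open>k \<bullet> (v\<^sub>i - v\<^sub>j)\<close>.
\<close>

lemma normal_on_edges:
  fixes v :: "'n::finite option \<Rightarrow> real^'n"
  assumes v: "ordered_simplex v" and k: "normalized_outward_normal v i k"
  shows "j \<noteq> i \<Longrightarrow> l \<noteq> i \<Longrightarrow> k \<bullet> (v j - v l) = 0"
    and "j \<noteq> i \<Longrightarrow> k \<bullet> (v j - v i) > 0"
proof -
  show zero: "k \<bullet> (v j - v l) = 0" if "j \<noteq> i" "l \<noteq> i" for j l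
    using k that vertex_in_face[of j i v] vertex_in_face[of l i v]
    by (simp add: normalized_outward_normal_def)
  assume j: "j \<noteq> i"
  have "affine hull (solid v) = UNIV"
    using simplex_affine_hull[OF v] by (simp add: solid_def)
  then have "interior (solid v) \<noteq> {}"
    using rel_interior_interior[of "solid v"] rel_interior_eq_empty[of "solid v"]
    by (simp add: solid_def)
  then obtain y where y: "y \<in> interior (solid v)" by auto
  then have neg: "k \<bullet> (y - v j) < 0"
    using k vertex_in_face[OF j, of v] by (simp add: normalized_outward_normal_def)
  have "y \<in> convex hull (range v)"
    using y interior_subset by (auto simp: solid_def)
  then obtain u where u: "\<And>x. x \<in> range v \<Longrightarrow> 0 \<le> u x" "sum u (range v) = 1"
      "(\<Sum>x\<in>range v. u x *\<^sub>R x) = y"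
    by (auto simp: convex_hull_finite)
  have inj: "inj v" using v by (simp add: ordered_simplex_def)
  have u': "(\<Sum>l\<in>UNIV. u (v l)) = 1" "(\<Sum>l\<in>UNIV. u (v l) *\<^sub>R v l) = y"
    using u inj by (simp_all add: sum.reindex)
  then have "y - v j = (\<Sum>l\<in>UNIV. u (v l) *\<^sub>R (v l - v j))"
    by (simp add: scaleR_diff_right sum_subtractf scaleR_sum_left[symmetric])
  then have "k \<bullet> (y - v j) = (\<Sum>l\<in>UNIV. u (v l) * (k \<bullet> (v l - v j)))"
    by (simp add: inner_sum_right)
  also have "\<dots> = (\<Sum>l\<in>UNIV. if l = i then u (v i) * (k \<bullet> (v i - v j)) else 0)"
    using zero j by (intro sum.cong) auto
  also have "\<dots> = u (v i) * (k \<bullet> (v i - v j))" by simp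
  finally have "u (v i) * (k \<bullet> (v i - v j)) < 0" using neg by simp
  then have "k \<bullet> (v i - v j) < 0"
    using u(1)[of "v i"] by (simp add: mult_less_0_iff)
  then show "k \<bullet> (v j - v i) > 0" by (simp add: inner_diff_right)
qed

lemma aff_dim_face:
  fixes v :: "'n::finite option \<Rightarrow> real^'n"
  assumes "ordered_simplex v"
  shows "aff_dim (face v i) = int (CARD('n) - 1)"
proof -
  have "\<not> affine_dependent (v ` (UNIV - {i}))"
    using assms affine_independent_subset[of "range v" "v ` (UNIV - {i})"]
    by (auto simp: ordered_simplex_def)
  then have "int (card (v ` (UNIV - {i}))) = aff_dim (face v i) + 1"
    using aff_dim_affine_independent by (simp add: face_def aff_dim_convex_hull)
  moreover have "card (v ` (UNIV - {i})) = CARD('n)"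
    using assms by (subst card_image)
      (auto simp: ordered_simplex_def card_UNIV_option intro: inj_on_subset)
  ultimately show ?thesis using zero_less_card_finite[where 'a='n] by simp
qed

lemma normal_frame:
  fixes v :: "'n::finite option \<Rightarrow> real^'n"
  assumes v: "ordered_simplex v" and k: "normalized_outward_normal v i k"
  obtains a b where "flat_frame (CARD('n) - 1) (face v i) a b"
    "norm k = frame_volume (CARD('n) - 1) (face v i) a b"
    "\<And>j. j < CARD('n) - 1 \<Longrightarrow> k \<bullet> b j = 0"
proof -
  obtain j where "j \<noteq> i" by (metis option.distinct(1))
  then have ne: "face v i \<noteq> {}" using vertex_in_face by blast
  note dim = aff_dim_face[OF v, of i]
  obtain a b where ab: "flat_frame (CARD('n) - 1) (face v i) a b"
      "flat_volume (CARD('n) - 1) (face v i) = frame_volume (CARD('n) - 1) (face v i) a b"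
    using flat_frame_exists[OF dim ne] flat_volume_frame by metis
  show thesis
    using that[OF ab(1)] ab(2) flat_frame_normal[OF ab(1) dim ne] k
    by (simp add: normalized_outward_normal_def)
qed

lemma normals_swap_on_edge:
  fixes v k :: "'n::finite option \<Rightarrow> real^'n"
  assumes n: "CARD('n) \<le> 3" and v: "ordered_simplex v"
    and k: "\<And>i. normalized_outward_normal v i (k i)" and "i \<noteq> l"
  shows "k i \<bullet> (v l - v i) = k l \<bullet> (v i - v l)"
proof -
  define W where "W = v ` (UNIV - {i, l})"
  have f: "face v i = convex hull (insert (v l) W)" "face v l = convex hull (insert (v i) W)"
    unfolding face_def W_def using \<open>i \<noteq> l\<close>
    by (auto intro!: arg_cong[where f="\<lambda>X. convex hull X"])
  obtain a b where ab: "flat_frame (CARD('n) - 1) (face v i) a b"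
    "norm (k i) = frame_volume (CARD('n) - 1) (face v i) a b"
    "\<And>j. j < CARD('n) - 1 \<Longrightarrow> k i \<bullet> b j = 0"
    by (rule normal_frame[OF v k, of i]) blast
  obtain c d where cd: "flat_frame (CARD('n) - 1) (face v l) c d"
    "norm (k l) = frame_volume (CARD('n) - 1) (face v l) c d"
    "\<And>j. j < CARD('n) - 1 \<Longrightarrow> k l \<bullet> d j = 0"
    by (rule normal_frame[OF v k, of l]) blast
  have pos: "k i \<bullet> (v l - v i) > 0" "k l \<bullet> (v i - v l) > 0"
    using normal_on_edges(2)[OF v k] \<open>i \<noteq> l\<close> by auto
  have "\<bar>k i \<bullet> (v i - v l)\<bar> = \<bar>k l \<bullet> (v l - v i)\<bar>"
  proof (rule inner_normals_swap[OF n, where W=W])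
    show "CARD('n) = Suc (CARD('n) - 1)" by simp
    show "finite W" by (simp add: W_def)
    show "k i \<bullet> (y - v l) = 0" if "y \<in> W" for y
      using that normal_on_edges(1)[OF v k] \<open>i \<noteq> l\<close> by (auto simp: W_def)
    show "k l \<bullet> (y - v i) = 0" if "y \<in> W" for y
      using that normal_on_edges(1)[OF v k] \<open>i \<noteq> l\<close> by (auto simp: W_def)
    show "k i \<bullet> (v i - v l) \<noteq> 0" "k l \<bullet> (v l - v i) \<noteq> 0"
      using pos by (auto simp: inner_diff_right)
  qed (use ab cd in \<open>simp_all add: f\<close>)
  then show ?thesis using pos by (simp add: inner_diff_right abs_if split: if_splits)
qed

text \<open>
  Up to the factor \<open>- c\<close>, the normals are the gradients of the barycentric coordinates.  The constant
  is \<open>n vol(\<Delta>)\<close>, obtained as \<open>vol(F\<^sub>i)\<close> times the height over \<open>F\<^sub>i\<close>.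
\<close>

lemma normals_dual_to_vertices:
  fixes v k :: "'n::finite option \<Rightarrow> real^'n"
  assumes n: "CARD('n) \<le> 3" and v: "ordered_simplex v"
    and k: "\<And>i. normalized_outward_normal v i (k i)"
  obtains c where "c > 0"
    "\<And>i j l. k i \<bullet> (v j - v l) = c * (of_bool (l = i) - of_bool (j = i))"
proof -
  note edge = normal_on_edges[OF v k] and swap = normals_swap_on_edge[OF n v k]
  \<comment> \<open>\<open>Some undefined\<close> stands for any vertex other than \<open>v\<^sub>0\<close>; \<open>shift\<close> below shows that the choice does not matter.\<close>
  define c where "c = k None \<bullet> (v (Some undefined) - v None)"
  have "c > 0" unfolding c_def by (rule edge(2)) simp
  have shift: "k i \<bullet> (v j - v i) = k i \<bullet> (v l - v i)" if "j \<noteq> i" "l \<noteq> i" for i j l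
    using edge(1)[OF that] by (simp add: inner_diff_right)
  have height: "k i \<bullet> (v j - v i) = c" if "j \<noteq> i" for i j
  proof (cases i)
    case None
    then show ?thesis using shift[of j None "Some undefined"] that by (simp add: c_def)
  next
    case (Some x)
    then have "k i \<bullet> (v j - v i) = k i \<bullet> (v None - v i)" using shift[of j i None] that by simp
    also have "\<dots> = k None \<bullet> (v i - v None)" using swap[of i None] Some by simp
    also have "\<dots> = c" using shift[of i None "Some undefined"] Some by (simp add: c_def)
    finally show ?thesis .
  qed
  have "k i \<bullet> (v j - v l) = c * (of_bool (l = i) - of_bool (j = i))" for i j l
  proof (cases "j = i")
    case True
    then show ?thesis using height[of l i] by (cases "l = i") (simp_all add: inner_diff_right)
  next
    case False
    then show ?thesis using height[of j i] edge(1)[of j i l] by (cases "l = i") simp_all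
  qed
  then show thesis using that \<open>c > 0\<close> by blast
qed

section \<open>The contact matrix\<close>

lemma abs_sum_less:
  fixes f :: "'i \<Rightarrow> real"
  assumes "finite I" "a \<in> I" "b \<in> I" "f a > 0" "f b < 0"
  shows "\<bar>sum f I\<bar> < (\<Sum>i\<in>I. \<bar>f i\<bar>)"
proof -
  have "sum f I < (\<Sum>i\<in>I. \<bar>f i\<bar>)"
    by (rule sum_strict_mono_ex1) (use assms in \<open>auto intro: bexI[of _ b]\<close>)
  moreover have "(\<Sum>i\<in>I. - f i) < (\<Sum>i\<in>I. \<bar>f i\<bar>)"
    by (rule sum_strict_mono_ex1) (use assms in \<open>auto intro: bexI[of _ a]\<close>)
  ultimately show ?thesis by (simp add: sum_negf)
qed

lemma sum_zero_sign_change: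
  fixes y :: "'i \<Rightarrow> real"
  assumes "finite I" "sum y I = 0" "i \<in> I" "y i \<noteq> 0"
  obtains a b where "a \<in> I" "b \<in> I" "y a > 0" "y b < 0"
proof -
  have "\<exists>a\<in>I. y a > 0"
  proof (rule ccontr)
    assume "\<not> ?thesis"
    then have "\<And>j. j \<in> I \<Longrightarrow> 0 \<le> - y j" by force
    moreover have "(\<Sum>j\<in>I. - y j) = 0" using assms(2) by (simp add: sum_negf)
    ultimately have "- y i = 0" using assms(1,3) sum_nonneg_eq_0_iff[of I "\<lambda>j. - y j"] by auto
    then show False using assms(4) by simp
  qed
  moreover have "\<exists>b\<in>I. y b < 0"
  proof (rule ccontr)
    assume "\<not> ?thesis"
    then have "\<And>j. j \<in> I \<Longrightarrow> 0 \<le> y j" by force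
    then have "y i = 0" using assms(1,2,3) sum_nonneg_eq_0_iff[of I y] by auto
    then show False using assms(4) by simp
  qed
  ultimately show thesis using that by blast
qed

text \<open>
  A stochastic matrix (scaled by \<open>\<tau>\<close>) contracts the sum of absolute values.  The contraction is strict
  for a vector \<open>y \<noteq> 0\<close> with entries of sum zero: such a \<open>y\<close> has entries of both signs, and they cancel
  partially in any column \<open>c\<close> whose zero diagonal entry meets neither of them; three indices leave room
  for such a \<open>c\<close>.
\<close>

lemma eigenvalue_bound:
  fixes \<beta> :: "'i::finite \<Rightarrow> 'i \<Rightarrow> real"
  assumes card: "CARD('i) \<ge> 3"
    and row: "\<And>i. (\<Sum>j\<in>UNIV. \<beta> i j) = \<tau>"
    and diag: "\<And>i. \<beta> i i = 0" and off: "\<And>i j. i \<noteq> j \<Longrightarrow> \<beta> i j > 0"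
    and y: "(\<Sum>i\<in>UNIV. y i) = 0" "y i0 \<noteq> 0"
    and eig: "\<And>j. \<mu> * y j = (\<Sum>i\<in>UNIV. y i * \<beta> i j)"
  shows "\<bar>\<mu>\<bar> < \<tau>"
proof -
  obtain a b where ab: "y a > 0" "y b < 0"
    using sum_zero_sign_change[of UNIV y i0] y by auto
  have "card {a, b} < CARD('i)"
    using card card_insert_le_m1[of 2 "{b}" a] by (auto simp: card_insert_if)
  then obtain c where c: "c \<noteq> a" "c \<noteq> b"
    by (metis UNIV_eq_I insertCI less_irrefl insert_iff empty_iff)
  have nonneg: "\<beta> i j \<ge> 0" for i j
    using diag[of i] off[of i j] by (cases "i = j") auto
  have le: "\<bar>\<mu>\<bar> * \<bar>y j\<bar> \<le> (\<Sum>i\<in>UNIV. \<bar>y i\<bar> * \<beta> i j)" for j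
    using sum_abs[of "\<lambda>i. y i * \<beta> i j" UNIV] nonneg
    by (simp add: eig[symmetric] abs_mult)
  have "\<bar>\<Sum>i\<in>UNIV. y i * \<beta> i c\<bar> < (\<Sum>i\<in>UNIV. \<bar>y i * \<beta> i c\<bar>)"
    by (rule abs_sum_less[of _ a b]) (use ab off[of a c] off[of b c] c in \<open>auto simp: mult_neg_pos\<close>)
  then have less: "\<bar>\<mu>\<bar> * \<bar>y c\<bar> < (\<Sum>i\<in>UNIV. \<bar>y i\<bar> * \<beta> i c)"
    using nonneg by (simp add: eig[symmetric] abs_mult)
  have "\<bar>\<mu>\<bar> * (\<Sum>j\<in>UNIV. \<bar>y j\<bar>) < (\<Sum>j\<in>UNIV. \<Sum>i\<in>UNIV. \<bar>y i\<bar> * \<beta> i j)"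
    unfolding sum_distrib_left by (rule sum_strict_mono_ex1) (use le less in auto)
  also have "\<dots> = (\<Sum>i\<in>UNIV. \<bar>y i\<bar> * \<tau>)"
    by (subst sum.swap) (simp add: sum_distrib_left[symmetric] row)
  also have "\<dots> = \<tau> * (\<Sum>j\<in>UNIV. \<bar>y j\<bar>)"
    by (simp add: sum_distrib_left mult.commute)
  finally show ?thesis
    using sum_nonneg[of UNIV "\<lambda>j. \<bar>y j\<bar>"] by (simp add: mult_less_cancel_right)
qed

lemma contact_matrix_entry: "contact_matrix k p $ r $ c = (\<Sum>i\<in>UNIV. k i $ r * p i $ c)"
  by (simp add: contact_matrix_def matrix_matrix_mult_def columnvector_def rowvector_def)

lemma contact_matrix_mult_vector: "contact_matrix k p *v x = (\<Sum>i\<in>UNIV. (p i \<bullet> x) *\<^sub>R k i)"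
proof -
  have "(contact_matrix k p *v x) $ r = (\<Sum>i\<in>UNIV. (p i \<bullet> x) *\<^sub>R k i) $ r" for r
  proof -
    have "(contact_matrix k p *v x) $ r = (\<Sum>c\<in>UNIV. \<Sum>i\<in>UNIV. k i $ r * p i $ c * x $ c)"
      by (simp add: matrix_vector_mult_def contact_matrix_entry sum_distrib_right)
    also have "\<dots> = (\<Sum>i\<in>UNIV. \<Sum>c\<in>UNIV. k i $ r * p i $ c * x $ c)" by (rule sum.swap)
    also have "\<dots> = (\<Sum>i\<in>UNIV. (p i \<bullet> x) * k i $ r)"
      by (simp add: inner_vec_def sum_distrib_left mult_ac)
    finally show ?thesis by simp
  qed
  then show ?thesis by (simp add: vec_eq_iff)
qed

lemma transpose_contact_matrix: "transpose (contact_matrix k p) = contact_matrix p k"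
  by (simp add: vec_eq_iff transpose_def contact_matrix_entry mult.commute)

lemma trace_contact_matrix_transpose:
  "trace (contact_matrix k p ** transpose X) = (\<Sum>i\<in>UNIV. k i \<bullet> (X *v p i))"
proof -
  have "trace (contact_matrix k p ** transpose X) =
      (\<Sum>r\<in>UNIV. \<Sum>c\<in>UNIV. \<Sum>i\<in>UNIV. k i $ r * p i $ c * X $ r $ c)"
    by (simp add: trace_def matrix_matrix_mult_def transpose_def contact_matrix_entry sum_distrib_right)
  also have "\<dots> = (\<Sum>r\<in>UNIV. \<Sum>i\<in>UNIV. \<Sum>c\<in>UNIV. k i $ r * p i $ c * X $ r $ c)"
    by (intro sum.cong refl sum.swap)
  also have "\<dots> = (\<Sum>i\<in>UNIV. \<Sum>r\<in>UNIV. \<Sum>c\<in>UNIV. k i $ r * p i $ c * X $ r $ c)"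
    by (rule sum.swap)
  finally show ?thesis
    by (simp add: inner_vec_def matrix_vector_mult_def sum_distrib_left mult_ac)
qed

lemma trace_contact_matrix: "trace (contact_matrix k p) = (\<Sum>i\<in>UNIV. k i \<bullet> p i)"
  using trace_contact_matrix_transpose[of k p "mat 1"] by simp

text \<open>
  For a top eigenvector \<open>e\<close>, pairing \<open>A e = \<mu> e\<close> with the normals turns it into an eigenvector
  \<open>(k\<^sub>i \<bullet> e)\<^sub>i\<close>, for the eigenvalue \<open>- \<mu>\<close>, of the matrix with entries \<open>k\<^sub>j \<bullet> (p\<^sub>j - p\<^sub>i)\<close>.  These are,
  up to scale, the barycentric coordinates of the contact points, and the row sums are \<open>tr A\<close>.
\<close>

lemma contact_matrix_rayleigh:
  fixes k p :: "'n::finite option \<Rightarrow> real^'n"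
  assumes n: "CARD('n) \<ge> 2" 
    and sym: "transpose (contact_matrix k p) = contact_matrix k p"
    and sum0: "(\<Sum>i\<in>UNIV. k i) = 0"
    and span: "\<And>w. (\<And>i. k i \<bullet> w = 0) \<Longrightarrow> w = 0"
    and off: "\<And>i j. i \<noteq> j \<Longrightarrow> k j \<bullet> (p i - p j) < 0"
    and "w \<noteq> 0"
  shows "w \<bullet> (contact_matrix k p *v w) < trace (contact_matrix k p) * (w \<bullet> w)"
proof -
  let ?A = "contact_matrix k p"
  obtain e \<mu> where e: "e \<noteq> 0" "?A *v e = \<mu> *\<^sub>R e"
    and max: "\<And>x. x \<bullet> (?A *v x) \<le> \<mu> * (x \<bullet> x)"
    using max_eigenvector[OF sym] by blast
  have sum0': "(\<Sum>i\<in>UNIV. k i \<bullet> x) = 0" for x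
    using sum0 by (simp add: inner_sum_left[symmetric])
  have Ae: "?A *v e = (\<Sum>i\<in>UNIV. (k i \<bullet> e) *\<^sub>R p i)"
    using contact_matrix_mult_vector[of p k e] sym by (simp add: transpose_contact_matrix)
  have "\<bar>- \<mu>\<bar> < trace ?A"
  proof (rule eigenvalue_bound[where \<beta>="\<lambda>i j. - (k j \<bullet> (p i - p j))" and y="\<lambda>i. k i \<bullet> e"])
    show "CARD('n option) \<ge> 3" using n by (simp add: card_UNIV_option)
    show "(\<Sum>j\<in>UNIV. - (k j \<bullet> (p i - p j))) = trace ?A" for i
      by (simp add: inner_diff_right sum_subtractf sum0' trace_contact_matrix)
    show "(\<Sum>i\<in>UNIV. k i \<bullet> e) = 0" by (rule sum0')
    show "k (SOME i. k i \<bullet> e \<noteq> 0) \<bullet> e \<noteq> 0"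
      using span[of e] e(1) by (intro someI_ex[of "\<lambda>i. k i \<bullet> e \<noteq> 0"]) auto
    show "- \<mu> * (k j \<bullet> e) = (\<Sum>i\<in>UNIV. (k i \<bullet> e) * - (k j \<bullet> (p i - p j)))" for j
    proof -
      have "\<mu> * (k j \<bullet> e) = k j \<bullet> (?A *v e)" by (simp add: e)
      also have "\<dots> = (\<Sum>i\<in>UNIV. (k i \<bullet> e) * (k j \<bullet> p i))"
        by (simp add: Ae inner_sum_right)
      also have "\<dots> = (\<Sum>i\<in>UNIV. (k i \<bullet> e) * (k j \<bullet> (p i - p j)))"
        by (simp add: inner_diff_right right_diff_distrib sum_subtractf
            sum_distrib_right[symmetric] sum0')
      finally show ?thesis by (simp add: sum_negf)
    qed
  qed (use off in auto)
  then have "\<mu> * (w \<bullet> w) < trace ?A * (w \<bullet> w)"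
    using \<open>w \<noteq> 0\<close> by (intro mult_strict_right_mono) auto
  then show ?thesis using max[of w] by linarith
qed

lemma normals_sum_zero:
  fixes v k :: "'i::finite \<Rightarrow> 'a::real_inner"
  assumes "affine hull (range v) = UNIV" "inj v"
    and dual: "\<And>i j l. k i \<bullet> (v j - v l) = c * (of_bool (l = i) - of_bool (j = i))"
  shows "(\<Sum>i\<in>UNIV. k i) = 0"
proof -
  let ?K = "\<Sum>i\<in>UNIV. k i"
  have "?K \<bullet> (v j - v l) = 0" for j l
    by (simp add: inner_sum_left dual sum_distrib_left[symmetric] sum_subtractf)
  moreover obtain u q where "?K = (\<Sum>j\<in>UNIV. u j *\<^sub>R (v j - v q))"
    using vector_as_edge_combination[OF assms(1,2)] by metis
  ultimately have "?K \<bullet> ?K = 0"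
    by (metis (no_types, lifting) inner_scaleR_right inner_sum_right mult_zero_right sum.neutral)
  then show ?thesis by simp
qed

lemma normals_separate:
  fixes v k :: "'i::finite \<Rightarrow> 'a::real_inner"
  assumes "affine hull (range v) = UNIV" "inj v" "c \<noteq> 0"
    and dual: "\<And>i j l. k i \<bullet> (v j - v l) = c * (of_bool (l = i) - of_bool (j = i))"
    and w: "\<And>i. k i \<bullet> w = 0"
  shows "w = 0"
proof -
  obtain u q where u: "w = (\<Sum>j\<in>UNIV. u j *\<^sub>R (v j - v q))"
    using vector_as_edge_combination[OF assms(1,2)] by metis
  have "u i *\<^sub>R (v i - v q) = 0" for i
  proof (cases "i = q")
    case False
    have "k i \<bullet> w = (\<Sum>j\<in>UNIV. if j = i then - (u i * c) else 0)"
      unfolding u inner_sum_right using False by (intro sum.cong) (auto simp: dual)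
    then show ?thesis using w[of i] \<open>c \<noteq> 0\<close> by simp
  qed simp
  then show ?thesis unfolding u by (intro sum.neutral ballI)
qed

text \<open>
  A relative interior point of facet \<open>i\<close> gives positive weight to \<open>v\<^sub>j\<close>, the only vertex off the
  hyperplane of facet \<open>j\<close>.
\<close>

lemma normal_neg_on_other_face:
  fixes v :: "'n::finite option \<Rightarrow> real^'n"
  assumes v: "ordered_simplex v" and k: "normalized_outward_normal v j k"
    and p: "p \<in> face v j" and x: "x \<in> rel_interior (face v i)" and "i \<noteq> j"
  shows "k \<bullet> (x - p) < 0"
proof -
  let ?W = "v ` (UNIV - {i})"
  have inj: "inj v" using v by (simp add: ordered_simplex_def)
  have "\<not> affine_dependent ?W"
    using v affine_independent_subset[of "range v" ?W] by (auto simp: ordered_simplex_def)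
  then obtain u where u: "\<And>y. y \<in> ?W \<Longrightarrow> 0 < u y" "sum u ?W = 1" "(\<Sum>y\<in>?W. u y *\<^sub>R y) = x"
    using x by (auto simp: face_def rel_interior_convex_hull_explicit)
  have inj': "inj_on v (UNIV - {i})" using inj by (rule inj_on_subset) simp
  have u': "(\<Sum>l\<in>UNIV - {i}. u (v l)) = 1" "(\<Sum>l\<in>UNIV - {i}. u (v l) *\<^sub>R v l) = x"
    using u(2,3) by (simp_all add: sum.reindex[OF inj'])
  have vi: "v i \<in> face v j" using \<open>i \<noteq> j\<close> by (rule vertex_in_face)
  have "x - v i = (\<Sum>l\<in>UNIV - {i}. u (v l) *\<^sub>R (v l - v i))"
    using u' by (simp add: scaleR_diff_right sum_subtractf scaleR_sum_left[symmetric])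
  then have "k \<bullet> (x - v i) = (\<Sum>l\<in>UNIV - {i}. u (v l) * (k \<bullet> (v l - v i)))"
    by (simp add: inner_sum_right)
  also have "\<dots> = (\<Sum>l\<in>UNIV - {i}. if l = j then u (v j) * (k \<bullet> (v j - v i)) else 0)"
    using normal_on_edges(1)[OF v k] \<open>i \<noteq> j\<close> by (intro sum.cong) auto
  also have "\<dots> = u (v j) * (k \<bullet> (v j - v i))"
    using \<open>i \<noteq> j\<close> by simp
  also have "\<dots> < 0"
    using u(1)[of "v j"] normal_on_edges(2)[OF v k, of i] \<open>i \<noteq> j\<close>
    by (intro mult_pos_neg) (auto simp: inner_diff_right)
  finally have "k \<bullet> (x - v i) < 0" .
  moreover have "k \<bullet> (v i - p) = 0"
    using k p vi by (simp add: normalized_outward_normal_def)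
  ultimately show ?thesis by (simp add: inner_diff_right)
qed

text \<open>
  The facet inequalities define an open set, and on it the numbers \<open>b\<^sub>i = - k\<^sub>i \<bullet> (z - p\<^sub>i) / c\<close> are
  barycentric coordinates of \<open>z\<close>: they are nonnegative, add up to one, and the combination of the
  vertices with these weights has the same inner products with all normals as \<open>z\<close>.
\<close>

lemma interior_solid_if_inside_facets:
  fixes v k p :: "'n::finite option \<Rightarrow> real^'n"
  assumes v: "ordered_simplex v" and k: "\<And>i. normalized_outward_normal v i (k i)"
    and p: "\<And>i. p i \<in> face v i" and "c > 0"
    and dual: "\<And>i j l. k i \<bullet> (v j - v l) = c * (of_bool (l = i) - of_bool (j = i))"
    and x: "\<And>i. k i \<bullet> (x - p i) < 0"
  shows "x \<in> interior (solid v)"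
proof (rule interiorI)
  have inj: "inj v" using v by (simp add: ordered_simplex_def)
  note hull = simplex_affine_hull[OF v]
  let ?U = "\<Inter>i. {x. k i \<bullet> (x - p i) < 0}"
  show "open ?U"
    by (intro open_INT ballI open_Collect_less continuous_intros) auto
  show "x \<in> ?U" using x by simp
  show "?U \<subseteq> solid v"
  proof
    fix z assume z: "z \<in> ?U"
    define b where "b i = - (k i \<bullet> (z - p i)) / c" for i
    have sum0: "(\<Sum>i\<in>UNIV. k i \<bullet> x) = 0" for x
      using normals_sum_zero[OF hull inj dual] by (simp add: inner_sum_left[symmetric])
    have kv: "k i \<bullet> (v j - p i) = - c * of_bool (j = i)" for i j
    proof -
      obtain q where q: "q \<noteq> i" by (metis option.distinct(1))
      then have "k i \<bullet> (v q - p i) = 0"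
        using k[of i] p[of i] vertex_in_face[OF q, of v] by (simp add: normalized_outward_normal_def)
      then show ?thesis using dual[of i j q] q by (simp add: inner_diff_right)
    qed
    have "(\<Sum>i\<in>UNIV. k i \<bullet> (v q - p i)) = - c" for q
      unfolding kv by (simp add: sum_distrib_left[symmetric] sum_negf)
    then have "(\<Sum>i\<in>UNIV. k i \<bullet> p i) = c"
      by (simp add: inner_diff_right sum_subtractf sum0)
    then have b1: "sum b UNIV = 1"
      using \<open>c > 0\<close> unfolding b_def
      by (simp add: inner_diff_right sum_divide_distrib[symmetric] sum_subtractf sum0)
    have b0: "b i \<ge> 0" for i
      using z \<open>c > 0\<close> by (auto simp: b_def divide_le_0_iff less_imp_le)
    have "z - (\<Sum>j\<in>UNIV. b j *\<^sub>R v j) = 0"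
    proof (rule normals_separate[OF hull inj _ dual])
      fix i
      have "k i \<bullet> (z - (\<Sum>j\<in>UNIV. b j *\<^sub>R v j)) =
          k i \<bullet> (z - p i) - k i \<bullet> (\<Sum>j\<in>UNIV. b j *\<^sub>R (v j - p i))"
        using b1 by (simp add: scaleR_diff_right sum_subtractf scaleR_sum_left[symmetric]
            inner_diff_right)
      also have "k i \<bullet> (\<Sum>j\<in>UNIV. b j *\<^sub>R (v j - p i)) =
          (\<Sum>j\<in>UNIV. if j = i then - c * b i else 0)"
        unfolding inner_sum_right inner_scaleR_right kv by (intro sum.cong) auto
      also have "\<dots> = - c * b i" by simp
      also have "k i \<bullet> (z - p i) - - c * b i = 0"
        using \<open>c > 0\<close> by (simp add: b_def)
      finally show "k i \<bullet> (z - (\<Sum>j\<in>UNIV. b j *\<^sub>R v j)) = 0" .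
    qed (use \<open>c > 0\<close> in simp)
    then have "z = (\<Sum>j\<in>UNIV. b j *\<^sub>R v j)" by simp
    also have "\<dots> \<in> solid v"
      unfolding solid_def using b0 b1 by (intro convex_sum) (auto simp: hull_inc)
    finally show "z \<in> solid v" .
  qed
qed

lemma linear_move: "linear (\<lambda>g. move g x)"
  by (rule linearI)
    (simp_all add: move_def matrix_vector_mult_add_rdistrib scaleR_matrix_vector_assoc[symmetric]
      scaleR_add_right)

lemma continuous_on_det:
  fixes f :: "'a::topological_space \<Rightarrow> real^'n^'n"
  assumes "continuous_on S f"
  shows "continuous_on S (\<lambda>x. det (f x))"
  unfolding det_def by (intro continuous_intros assms)

theorem proposition19:
  fixes v k p :: "'n::finite option \<Rightarrow> real^'n"
  assumes "CARD('n) \<le> 3"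
    and "ordered_simplex v"
    and "\<And>i. normalized_outward_normal v i (k i)"
    and "\<And>i. p i \<in> rel_interior (face v i)"
    and "transpose (contact_matrix k p) = contact_matrix k p"
  shows "immobilizes (range p) (solid v)"
proof -
  let ?A = "contact_matrix k p"
  obtain c where c: "c > 0"
    and dual: "\<And>i j l. k i \<bullet> (v j - v l) = c * (of_bool (l = i) - of_bool (j = i))"
    using normals_dual_to_vertices[OF assms(1-3)] by blast
  have inj: "inj v" using assms(2) by (simp add: ordered_simplex_def)
  note hull = simplex_affine_hull[OF assms(2)]
  have face: "p i \<in> face v i" for i
    using assms(4) rel_interior_subset by blast
  have sum0: "(\<Sum>i\<in>UNIV. k i) = 0" by (rule normals_sum_zero[OF hull inj dual])
  have span: "w = 0" if "\<And>i. k i \<bullet> w = 0" for w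
    by (rule normals_separate[OF hull inj _ dual that]) (use c in simp)
  have off: "k j \<bullet> (p i - p j) < 0" if "i \<noteq> j" for i j
    by (rule normal_neg_on_other_face[OF assms(2,3) face assms(4) that])
  have trace: "trace ?A > 0"
  proof -
    \<comment> \<open>The trace is any row sum of the matrix in \<open>contact_matrix_rayleigh\<close>; this is the row of \<open>p\<^sub>0\<close>.\<close>
    have "(\<Sum>j\<in>UNIV. - (k j \<bullet> (p None - p j))) > 0"
    proof (rule sum_pos2[of UNIV "Some undefined"])
      show "0 \<le> - (k j \<bullet> (p None - p j))" for j
        using off[of None j] by (cases "j = None") auto
    qed (use off[of None "Some undefined"] in auto)
    moreover have "(\<Sum>j\<in>UNIV. k j \<bullet> p None) = 0"
      using sum0 by (simp add: inner_sum_left[symmetric])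
    ultimately show ?thesis
      by (simp add: trace_contact_matrix inner_diff_right sum_subtractf)
  qed
  \<comment> \<open>The first condition makes the Cayley transform of the rotation available; the second keeps each \<open>g p\<^sub>i\<close> strictly inside all facet hyperplanes but its own.\<close>
  define T where "T = {g :: (real^'n^'n) \<times> (real^'n). det (fst g + mat 1) \<noteq> 0} \<inter>
    (\<Inter>(i, j) \<in> {(i, j). i \<noteq> j}. {g. k j \<bullet> (move g (p i) - p j) < 0})"
  define N where "N = rigid_motions \<inter> T"
  have move: "continuous_on UNIV (\<lambda>g. move g x)" for x :: "real^'n"
    by (intro linear_continuous_on) (simp add: linear_move linear_conv_bounded_linear[symmetric])
  have "open T"
    unfolding T_def
    by (intro open_Int open_INT ballI open_Collect_neq continuous_on_det continuous_intros)
      (auto intro!: open_Collect_less continuous_intros move)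
  then have "openin (top_of_set rigid_motions) N"
    by (auto simp: N_def openin_open)
  moreover have "(mat 1, 0) \<in> N"
  proof -
    have "(mat 1 + mat 1 :: real^'n^'n) = 2 *\<^sub>R mat 1" by (simp add: scaleR_2)
    then have "(mat 1 + mat 1 :: real^'n^'n) ** ((1/2) *\<^sub>R mat 1) = mat 1"
      by (simp add: matrix_scaleR_left matrix_scaleR_right)
    then have "det (mat 1 + mat 1 :: real^'n^'n) \<noteq> 0"
      by (metis det_I det_mul mult_zero_left zero_neq_one)
    then show ?thesis
      using off by (auto simp: N_def T_def rigid_motions_def rotation_matrix_def
          orthogonal_matrix_def move_def)
  qed
  moreover have "\<exists>x\<in>range p. move g x \<in> interior (solid v)" if g: "g \<in> N" "g \<noteq> (mat 1, 0)" for g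
  proof (rule ccontr)
    assume no: "\<not> ?thesis"
    obtain R a where Ra: "g = (R, a)" by (cases g)
    have R: "orthogonal_matrix R" "det (R + mat 1) \<noteq> 0"
      using g by (auto simp: Ra N_def T_def rigid_motions_def rotation_matrix_def)
    have nonneg: "k i \<bullet> (R *v p i + a - p i) \<ge> 0" for i
    proof (rule ccontr)
      assume "\<not> ?thesis"
      then have i: "k i \<bullet> (move g (p i) - p i) < 0" by (simp add: Ra move_def)
      have "k j \<bullet> (move g (p i) - p j) < 0" for j
        using i g by (cases "j = i") (auto simp: N_def T_def)
      then have "move g (p i) \<in> interior (solid v)"
        by (rule interior_solid_if_inside_facets[OF assms(2,3) face c dual])
      then show False using no by auto
    qed
    have total: "(\<Sum>i\<in>UNIV. k i \<bullet> (R *v p i + a - p i)) = trace (?A ** (R - mat 1))"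
    proof -
      have "k i \<bullet> (R *v p i + a - p i) = k i \<bullet> ((R - mat 1) *v p i) + k i \<bullet> a" for i
        by (simp add: inner_add_right inner_diff_right matrix_vector_mult_diff_rdistrib)
      then have "(\<Sum>i\<in>UNIV. k i \<bullet> (R *v p i + a - p i)) =
          (\<Sum>i\<in>UNIV. k i \<bullet> ((R - mat 1) *v p i)) + (\<Sum>i\<in>UNIV. k i) \<bullet> a"
        by (simp add: inner_sum_left sum.distrib)
      then show ?thesis
        using trace_contact_matrix_transpose[of k p "R - mat 1"]
          trace_symmetric_mult_transpose[OF assms(5)] by (simp add: sum0)
    qed
    show False
    proof (cases "R = mat 1")
      case False
      have "trace (?A ** (R - mat 1)) < 0"
      proof (rule trace_rotation_defect_neg[OF assms(1) R False assms(5) trace])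
        fix w :: "(real, 'n) vec" assume "CARD('n) = 3" "w \<noteq> 0"
        then show "w \<bullet> (?A *v w) < trace ?A * (w \<bullet> w)"
          using span off by (intro contact_matrix_rayleigh[OF _ assms(5) sum0]) simp_all
      qed
      moreover have "(\<Sum>i\<in>UNIV. k i \<bullet> (R *v p i + a - p i)) \<ge> 0"
        by (intro sum_nonneg nonneg)
      ultimately show False using total by linarith
    next
      case True
      then have "(\<Sum>i\<in>UNIV. k i \<bullet> a) = 0" "\<And>i. k i \<bullet> a \<ge> 0"
        using nonneg sum0 by (simp_all add: inner_sum_left[symmetric])
      then have "k i \<bullet> a = 0" for i
        using sum_nonneg_eq_0_iff[of UNIV "\<lambda>i. k i \<bullet> a"] by simp
      then have "a = 0" by (rule span)
      then show False using True g(2) Ra by simp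
    qed
  qed
  ultimately show ?thesis unfolding immobilizes_def by blast
qed

end
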